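(* Let $t\ge0$, $n,l$ be nonnegative integers, and write $t=3u$, $3u+1$ or $3u+2$ with $u\ge0$ an integer. Then \[ \mathcal{M}(P_t\vee S_{1,n}\vee S_{0,l})\simeq \begin{cases} S^{n+l+2u} & (t=3u),\\ (S^{n+l+2u+1})^{\vee l} & (t=3u+1),\\ (S^{n+l+2u+2})^{\vee(l-1)} & (t=3u+2). \end{cases} \]
   Context: Graphs are regarded as $1$-dimensional simplicial complexes (simplices: vertices and edges). A discrete vector field $V$ on a graph $G$ is a set of pairs $(v,e)$ with $v$ a vertex and $e$ an edge containing $v$, such that every vertex and every edge of $G$ occurs in at most one pair of $V$. A $V$-path is a sequence $v_0,e_0,v_1,e_1,\dots,e_{k-1},v_k$ with $(v_i,e_i)\in V$ and $v_{i+1}\neq v_i$ the other endpoint of $e_i$; it is closed if $v_k=v_0$ and non-trivial if $k\ge1$. $V$ is a gradient vector field if it has no non-trivial closed $V$-path. A primitive gradient vector field is a single pair $\{(v,e)\}$. The Morse complex $\mathcal{M}(G)$ is the simplicial complex whose vertices are the primitive gradient vector fields of $G$, a set of them forming a simplex iff their union is a gradient vector field. Homotopy equivalence refers to geometric realizations. $P_t$ is the path with vertices $v_0,\dots,v_t$ and edges $\{v_{i-1},v_i\}$, $1\le i\le t$. The extended star graph $S_{m,n}$ is the one-point union, at a common vertex (the center), of $m$ paths of length $1$ and $n$ paths of length $2$. $P_t\vee S_{m,n}\vee S_{k,l}$ denotes the graph obtained from $P_t$, $S_{m,n}$, $S_{k,l}$ by identifying the center of $S_{m,n}$ with $v_0$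 and the center of $S_{k,l}$ with $v_t$. $X^{\vee k}$ denotes the wedge of $k$ copies of $X$ (a point when $k=0$).
   Formalization: In the case t = 3u+2 the formal theorem assumes l ≥ 1, since for l = 0 the wedge of l−1 = −1 spheres is undefined (there the Morse complex is in fact a sphere, e.g. S^1 for t=2, n=l=0). *)

theory Defs
  imports "HOL-Analysis.Analysis"
begin

section \<open>Graphs\<close>

text \<open>A graph is a pair of a vertex set and a set of two-element edges.\<close>

type_synonym 'a graph = "'a set \<times> 'a set set"

abbreviation verts :: "'a graph \<Rightarrow> 'a set" where "verts G \<equiv> fst G"
abbreviation edges :: "'a graph \<Rightarrow> 'a set set" where "edges G \<equiv> snd G"

definition simple_graph :: "'a graph \<Rightarrow> bool" where
  "simple_graph G \<longleftrightarrow> (\<forall>e\<in>edges G. e \<subseteq> verts G \<and> card e = 2)"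

definition map_graph :: "('a \<Rightarrow> 'b) \<Rightarrow> 'a graph \<Rightarrow> 'b graph" where
  "map_graph f G = (f ` verts G, (image f) ` edges G)"

definition graph_union :: "'a graph \<Rightarrow> 'a graph \<Rightarrow> 'a graph" where
  "graph_union G H = (verts G \<union> verts H, edges G \<union> edges H)"

definition path_graph :: "nat \<Rightarrow> nat graph" where
  "path_graph t = ({0..t}, {{i - 1, i} | i. 1 \<le> i \<and> i \<le> t})"

text \<open>
  The extended star with m arms of length 1 (ending in the \<open>Leaf i\<close>) and n arms of
  length 2 (running through \<open>Mid j\<close> to \<open>Tip j\<close>).
\<close>

datatype star_vertex = Center | Leaf nat | Mid nat | Tip nat

definition extended_star :: "nat \<Rightarrow> nat \<Rightarrow> star_vertex graph" where
  "extended_star m n =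
     ({Center} \<union> Leaf ` {..<m} \<union> Mid ` {..<n} \<union> Tip ` {..<n},
      {{Center, Leaf i} | i. i < m} \<union>
      {{Center, Mid j} | j. j < n} \<union> {{Mid j, Tip j} | j. j < n})"

text \<open>
  The one-point unions with the two ends of the path: a star is mapped into the common
  vertex type by sending its center to the given vertex of the path (\<open>Spine 0\<close> or
  \<open>Spine t\<close>) and all its other vertices to new ones.  For \<open>t = 0\<close> all three
  distinguished vertices become the same.
\<close>

datatype glued_vertex = Spine nat | InLeft star_vertex | InRight star_vertex

definition attach :: "(star_vertex \<Rightarrow> glued_vertex) \<Rightarrow> glued_vertex \<Rightarrow> star_vertex \<Rightarrow> glued_vertex" where
  "attach h c x = (if x = Center then c else h x)"

definition path_two_stars ::
  "nat \<Rightarrow> star_vertex graph \<Rightarrow> star_vertex graph \<Rightarrow> glued_vertex graph" where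
  "path_two_stars t S T =
     graph_union (map_graph Spine (path_graph t))
       (graph_union (map_graph (attach InLeft (Spine 0)) S)
                    (map_graph (attach InRight (Spine t)) T))"

section \<open>Gradient vector fields and the Morse complex\<close>

definition discrete_vector_field :: "'a graph \<Rightarrow> ('a \<times> 'a set) set \<Rightarrow> bool" where
  "discrete_vector_field G V \<longleftrightarrow>
     (\<forall>(v, e)\<in>V. v \<in> verts G \<and> e \<in> edges G \<and> v \<in> e) \<and>
     (\<forall>p\<in>V. \<forall>q\<in>V. fst p = fst q \<or> snd p = snd q \<longrightarrow> p = q)"

definition V_path :: "('a \<times> 'a set) set \<Rightarrow> 'a list \<Rightarrow> 'a set list \<Rightarrow> bool" where
  "V_path V vs es \<longleftrightarrow>
     length vs = Suc (length es) \<and>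
     (\<forall>i<length es. (vs ! i, es ! i) \<in> V \<and>
        vs ! Suc i \<noteq> vs ! i \<and> es ! i = {vs ! i, vs ! Suc i})"

definition gradient_vector_field :: "'a graph \<Rightarrow> ('a \<times> 'a set) set \<Rightarrow> bool" where
  "gradient_vector_field G V \<longleftrightarrow>
     discrete_vector_field G V \<and>
     \<not> (\<exists>vs es. V_path V vs es \<and> es \<noteq> [] \<and> last vs = hd vs)"

definition primitive_gradient_vector_field :: "'a graph \<Rightarrow> ('a \<times> 'a set) set \<Rightarrow> bool" where
  "primitive_gradient_vector_field G V \<longleftrightarrow>
     gradient_vector_field G V \<and> (\<exists>v e. V = {(v, e)})"

text \<open>An abstract simplicial complex is given by its set of (nonempty, finite) simplices.\<close>

definition morse_complex :: "'a graph \<Rightarrow> ('a \<times> 'a set) set set set" where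
  "morse_complex G =
     {\<sigma>. \<sigma> \<noteq> {} \<and> finite \<sigma> \<and> (\<forall>W\<in>\<sigma>. primitive_gradient_vector_field G W) \<and>
         gradient_vector_field G (\<Union>\<sigma>)}"

section \<open>Geometric realization and wedges\<close>

text \<open>
  Barycentric coordinates with the subspace topology of the product topology; this is the
  usual realization for finite complexes, for which it coincides with the weak topology.
\<close>

definition geometric_realization :: "'v set set \<Rightarrow> ('v \<Rightarrow> real) topology" where
  "geometric_realization K =
     subtopology (powertop_real UNIV)
       {f. (\<forall>x. 0 \<le> f x) \<and> finite {x. f x \<noteq> 0} \<and> {x. f x \<noteq> 0} \<in> K \<and>
           (\<Sum>x | f x \<noteq> 0. f x) = 1}"

text \<open>
  The wedge of k copies of a space X with base point p, as the quotient of the disjoint union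
  of a point and k copies of X: \<open>None\<close> is the common base point and \<open>Some (i, x)\<close> is the
  point \<open>x \<noteq> p\<close> of the i-th copy.  The topology is the final one with respect to the
  inclusions of the copies.  For \<open>k = 0\<close> the wedge is a single point.
\<close>

definition wedge_inj :: "'a \<Rightarrow> nat \<Rightarrow> 'a \<Rightarrow> (nat \<times> 'a) option" where
  "wedge_inj p i x = (if x = p then None else Some (i, x))"

definition wedge_copies :: "nat \<Rightarrow> 'a topology \<Rightarrow> 'a \<Rightarrow> (nat \<times> 'a) option topology" where
  "wedge_copies k X p =
     topology (\<lambda>U. U \<subseteq> {None} \<union> (\<Union>i<k. wedge_inj p i ` topspace X) \<and>
                   (\<forall>i<k. openin X {x \<in> topspace X. wedge_inj p i x \<in> U}))"

definition sphere_base :: "nat \<Rightarrow> real" where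
  "sphere_base i = (if i = 0 then 1 else 0)"

definition sphere_wedge :: "nat \<Rightarrow> nat \<Rightarrow> (nat \<times> (nat \<Rightarrow> real)) option topology" where
  "sphere_wedge k d = wedge_copies k (nsphere d) sphere_base"

section \<open>Basic facts\<close>

lemma simple_graph_path_two_stars:
  "simple_graph (path_two_stars t (extended_star m n) (extended_star k l))"
  by (fastforce simp: simple_graph_def path_two_stars_def graph_union_def map_graph_def
      attach_def path_graph_def extended_star_def card_2_iff)

lemma finite_verts_path_two_stars:
  "finite (verts (path_two_stars t (extended_star m n) (extended_star k l)))"
  by (simp add: path_two_stars_def graph_union_def map_graph_def path_graph_def
      extended_star_def)

lemma gradient_vector_field_mono:
  "gradient_vector_field G V \<Longrightarrow> W \<subseteq> V \<Longrightarrow> gradient_vector_field G W"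
  unfolding gradient_vector_field_def discrete_vector_field_def V_path_def
  by (meson subsetD)

lemma morse_complex_closed:
  "\<sigma> \<in> morse_complex G \<Longrightarrow> \<tau> \<subseteq> \<sigma> \<Longrightarrow> \<tau> \<noteq> {} \<Longrightarrow> \<tau> \<in> morse_complex G"
  unfolding morse_complex_def
  using gradient_vector_field_mono[of G "\<Union>\<sigma>" "\<Union>\<tau>"]
  by (auto intro: finite_subset)

lemma openin_wedge_copies:
  "openin (wedge_copies k X p) U \<longleftrightarrow>
     U \<subseteq> {None} \<union> (\<Union>i<k. wedge_inj p i ` topspace X) \<and>
     (\<forall>i<k. openin X {x \<in> topspace X. wedge_inj p i x \<in> U})"
proof -
  let ?P = "\<lambda>U. U \<subseteq> {None} \<union> (\<Union>i<k. wedge_inj p i ` topspace X) \<and>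
     (\<forall>i<k. openin X {x \<in> topspace X. wedge_inj p i x \<in> U})"
  have "istopology ?P"
    unfolding istopology_def
  proof (intro conjI allI impI)
    fix S T i assume "?P S" "?P T" and i: "i < k"
    then have "openin X ({x \<in> topspace X. wedge_inj p i x \<in> S} \<inter> {x \<in> topspace X. wedge_inj p i x \<in> T})"
      by (intro openin_Int) auto
    moreover have "{x \<in> topspace X. wedge_inj p i x \<in> S} \<inter> {x \<in> topspace X. wedge_inj p i x \<in> T}
        = {x \<in> topspace X. wedge_inj p i x \<in> S \<inter> T}"
      by auto
    ultimately show "openin X {x \<in> topspace X. wedge_inj p i x \<in> S \<inter> T}"
      by simp
  next
    fix \<K> i assume "\<forall>K\<in>\<K>. ?P K" and i: "i < k"
    then have "openin X (\<Union>K\<in>\<K>. {x \<in> topspace X. wedge_inj p i x \<in> K})"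
      by (intro openin_Union) auto
    moreover have "(\<Union>K\<in>\<K>. {x \<in> topspace X. wedge_inj p i x \<in> K})
        = {x \<in> topspace X. wedge_inj p i x \<in> \<Union>\<K>}"
      by auto
    ultimately show "openin X {x \<in> topspace X. wedge_inj p i x \<in> \<Union>\<K>}"
      by simp
  qed blast+
  then show ?thesis
    by (simp add: wedge_copies_def topology_inverse')
qed

lemma topspace_wedge_copies:
  "topspace (wedge_copies k X p) = {None} \<union> (\<Union>i<k. wedge_inj p i ` topspace X)" (is "_ = ?A")
proof
  show "topspace (wedge_copies k X p) \<subseteq> ?A"
    using openin_wedge_copies[of k X p "topspace (wedge_copies k X p)"] by simp
  have "{x \<in> topspace X. wedge_inj p i x \<in> ?A} = topspace X" if "i < k" for i
    using that by blast
  then have "openin (wedge_copies k X p) ?A"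
    unfolding openin_wedge_copies by simp
  then show "?A \<subseteq> topspace (wedge_copies k X p)"
    by (rule openin_subset)
qed

lemma sphere_base_in_nsphere: "sphere_base \<in> topspace (nsphere d)"
proof -
  have "(\<Sum>i\<le>d. (sphere_base i)\<^sup>2) = (\<Sum>i\<le>d. if i = 0 then 1 else 0)"
    by (rule sum.cong) (auto simp: sphere_base_def)
  then have "(\<Sum>i\<le>d. (sphere_base i)\<^sup>2) = 1"
    by simp
  then show ?thesis
    by (simp add: nsphere sphere_base_def)
qed

end

theory Submission
  imports Defs
begin

text \<open>
  In a tree every discrete vector field is a gradient field, so the Morse complex is the independence
  complex of the graph in which two primitive fields are adjacent iff they share a vertex or an edge.
  If all neighbours of \<open>a\<close> are neighbours of \<open>b\<close>, deleting \<open>b\<close> does not change the homotopy type of an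
  independence complex. Such deletions, starting from the leaf of \<open>S_{1,n}\<close> and from the tips of the
  arms and then moving along the path in steps of three, leave disjoint edges and one clique. The
  independence complex of this graph is the join of the boundary of a cross-polytope with finitely
  many points; collapsing the cone over one of these points turns it into a wedge of spheres.
\<close>

section \<open>Maps into geometric realizations\<close>

text \<open>The residue of t modulo 3 decides what survives at the far end of the path. Numbered
  from v_0, the 2t fields along the path conflict exactly with their neighbours in this order. The
  leaf removes number 1; then 2 has the single neighbour 3 and removes 4, after which 5 removes 7,
  and so on, so that the pairs 3m+2, 3m+3 remain. The clique comes from the fields at v_t on the l
  arms there. For t = 3u the last pair is complete and removes these fields; the two fields on the
  leaf edge act as a clique of two instead. For t = 3u+1 an unpaired field at v_t joins them, and
  for t = 3u+2 they stay alone. A clique with k+1 vertices yields k spheres, because one cone is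
  used up by the collapse, and each matching edge adds one to the dimension.

  Homotopies between realizations are straight segments, for which it is enough that a point and its
  image have supports in a common simplex. The comparison with the wedge of spheres is the one place
  where this fails directly, and it needs an intermediate map.\<close>

definition support :: "('v \<Rightarrow> real) \<Rightarrow> 'v set" where
  "support f = {v. f v \<noteq> 0}"

text \<open>Whether the empty set belongs to \<open>K\<close> is left open: the coordinates of a
  point of the realization sum to 1, so its support is nonempty in either case.\<close>

definition complex_on :: "'v set \<Rightarrow> 'v set set \<Rightarrow> bool" where
  "complex_on V K \<longleftrightarrow>
     finite V \<and> K \<subseteq> Pow V \<and> (\<forall>\<sigma>\<in>K. \<forall>\<tau>. \<tau> \<subseteq> \<sigma> \<and> \<tau> \<noteq> {} \<longrightarrow> \<tau> \<in> K)"

lemma complex_onD: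
  assumes "complex_on V K"
  shows "finite V" "\<sigma> \<in> K \<Longrightarrow> \<sigma> \<subseteq> V" "\<sigma> \<in> K \<Longrightarrow> \<tau> \<subseteq> \<sigma> \<Longrightarrow> \<tau> \<noteq> {} \<Longrightarrow> \<tau> \<in> K"
  using assms unfolding complex_on_def by auto

text \<open>Summing over the fixed finite set \<open>V\<close> instead of over the support makes the
  normalization linear in \<open>f\<close>, as convex combinations require.\<close>

lemma topspace_geometric_realization:
  assumes "complex_on V K"
  shows "topspace (geometric_realization K) =
    {f. (\<forall>x. 0 \<le> f x) \<and> support f \<in> K \<and> sum f V = 1}"
proof -
  have "sum f {x. f x \<noteq> 0} = sum f V" if "{x. f x \<noteq> 0} \<subseteq> V" for f :: "'a \<Rightarrow> real"
    using complex_onD(1)[OF assms] that by (intro sum.mono_neutral_left) auto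
  moreover have "{x. f x \<noteq> 0} \<in> K \<Longrightarrow> {x. f x \<noteq> 0} \<subseteq> V" for f :: "'a \<Rightarrow> real"
    using complex_onD(2)[OF assms] .
  ultimately show ?thesis
    using complex_onD(1)[OF assms] unfolding geometric_realization_def support_def
    by (auto intro: finite_subset)
qed

lemma support_nonempty: "sum f V \<noteq> 0 \<Longrightarrow> support f \<noteq> {}"
  unfolding support_def by (metis (mono_tags, lifting) empty_Collect_eq sum.neutral)

lemma in_geometric_realizationD:
  assumes "complex_on V K" "f \<in> topspace (geometric_realization K)"
  shows "0 \<le> f x" "support f \<in> K" "sum f V = 1" "support f \<noteq> {}"
  using assms(2) support_nonempty[of f V] unfolding topspace_geometric_realization[OF assms(1)]
  by auto

lemma continuous_map_realization_coordinate [continuous_intros]: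
  "continuous_map (geometric_realization K) euclideanreal (\<lambda>f. f v)"
  unfolding geometric_realization_def
  by (blast intro: continuous_map_from_subtopology [OF continuous_map_product_projection])

lemma continuous_map_coordinate_of_realization:
  "continuous_map X (geometric_realization K) f \<Longrightarrow> continuous_map X euclideanreal (\<lambda>x. f x v)"
  using continuous_map_compose[OF _ continuous_map_realization_coordinate, of X K f v]
  by (simp add: o_def)

lemma continuous_map_into_realization:
  assumes K: "complex_on V K"
    and "\<And>v. continuous_map X euclideanreal (\<lambda>x. f x v)"
    and "\<And>x. x \<in> topspace X \<Longrightarrow> f x \<in> topspace (geometric_realization K)"
  shows "continuous_map X (geometric_realization K) f"
  using assms(2,3) unfolding geometric_realization_def
  by (auto simp: continuous_map_in_subtopology continuous_map_componentwise_UNIV Pi_iff)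

text \<open>Allows maps into a realization to be given by arbitrary nonnegative weights: dividing by
  the total does not change the support, and the support alone decides whether the result lies in
  the complex.\<close>

definition normalize_weights :: "'v set \<Rightarrow> ('v \<Rightarrow> real) \<Rightarrow> 'v \<Rightarrow> real" where
  "normalize_weights V w v = w v / sum w V"

lemma sum_pos_of_support:
  fixes w :: "'v \<Rightarrow> real"
  assumes "finite V" "\<And>v. 0 \<le> w v" "support w \<subseteq> V" "support w \<noteq> {}"
  shows "0 < sum w V"
proof -
  obtain v where "v \<in> support w" using assms(4) by blast
  then have "v \<in> V" "0 < w v" using assms(2)[of v] assms(3) by (auto simp: support_def)
  then show ?thesis using assms by (intro sum_pos2) auto
qed

lemma normalize_weights_in_realization:
  assumes K: "complex_on V K" and "\<And>v. 0 \<le> w v" "support w \<in> K" "support w \<noteq> {}"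
  shows "normalize_weights V w \<in> topspace (geometric_realization K)" "support (normalize_weights V w) = support w"
proof -
  have pos: "0 < sum w V"
    using assms complex_onD[OF K] by (intro sum_pos_of_support) auto
  then show "support (normalize_weights V w) = support w"
    by (auto simp: support_def normalize_weights_def)
  moreover have "sum (normalize_weights V w) V = 1"
    using pos unfolding normalize_weights_def by (simp flip: sum_divide_distrib)
  ultimately show "normalize_weights V w \<in> topspace (geometric_realization K)"
    using pos assms unfolding topspace_geometric_realization[OF K]
    by (auto simp: normalize_weights_def)
qed

lemma continuous_map_normalize_weights:
  assumes K: "complex_on V K"
    and cont: "\<And>v. continuous_map X euclideanreal (\<lambda>x. w x v)"
    and w: "\<And>x v. x \<in> topspace X \<Longrightarrow> 0 \<le> w x v"
      "\<And>x. x \<in> topspace X \<Longrightarrow> support (w x) \<in> K" "\<And>x. x \<in> topspace X \<Longrightarrow> support (w x) \<noteq> {}"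
  shows "continuous_map X (geometric_realization K) (\<lambda>x. normalize_weights V (w x))"
proof (rule continuous_map_into_realization[OF K])
  have "sum (w x) V \<noteq> 0" if "x \<in> topspace X" for x
    using sum_pos_of_support[of V "w x"] w[OF that] complex_onD[OF K] by force
  then show "continuous_map X euclideanreal (\<lambda>x. normalize_weights V (w x) v)" for v
    unfolding normalize_weights_def using complex_onD(1)[OF K] by (intro continuous_intros cont) auto
qed (use normalize_weights_in_realization[OF K] w in auto)

text \<open>The homotopy moves every point along the straight segment in the common simplex.\<close>

lemma homotopic_with_common_carrier:
  assumes K: "complex_on V K"
    and f: "continuous_map X (geometric_realization K) f"
    and g: "continuous_map X (geometric_realization K) g"
    and carrier: "\<And>x. x \<in> topspace X \<Longrightarrow> support (f x) \<union> support (g x) \<in> K"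
  shows "homotopic_with (\<lambda>_. True) X (geometric_realization K) f g"
proof -
  let ?I = "top_of_set {0..1::real}"
  define h where "h = (\<lambda>(s, x) v. (1 - s) * f x v + s * g x v)"
  have "continuous_map (prod_topology ?I X) (geometric_realization K) h"
  proof (rule continuous_map_into_realization[OF K])
    have c: "continuous_map (prod_topology ?I X) euclideanreal (\<lambda>p. k (snd p) v)"
      if "continuous_map X (geometric_realization K) k" for k v
      using continuous_map_compose[OF continuous_map_snd
          continuous_map_coordinate_of_realization[OF that]]
      by (simp add: o_def)
    have I: "continuous_map (prod_topology ?I X) euclideanreal fst"
      using continuous_map_into_fulltopology[OF continuous_map_fst] .
    show "continuous_map (prod_topology ?I X) euclideanreal (\<lambda>p. h p v)" for v
      unfolding h_def case_prod_unfold by (intro continuous_intros c f g I)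
    fix p assume p: "p \<in> topspace (prod_topology ?I X)"
    obtain s x where [simp]: "p = (s, x)" by (cases p)
    have s: "0 \<le> s" "s \<le> 1" and x: "x \<in> topspace X" using p by auto
    have fx: "f x \<in> topspace (geometric_realization K)" and gx: "g x \<in> topspace (geometric_realization K)"
      using x f g continuous_map_image_subset_topspace by blast+
    note F = in_geometric_realizationD[OF K fx] and G = in_geometric_realizationD[OF K gx]
    have sum1: "sum (h p) V = 1"
      using F(3) G(3) by (simp add: h_def sum.distrib flip: sum_distrib_left)
    \<comment> \<open>Only an inclusion holds, since at the ends of the segment one of the two
      supports may drop out; closure of \<open>K\<close> under nonempty subsets makes up for
      it.\<close>
    have "support (h p) \<subseteq> support (f x) \<union> support (g x)"
      by (auto simp: h_def support_def)
    moreover have "support (h p) \<noteq> {}"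
      using sum1 support_nonempty[of "h p" V] by simp
    ultimately have "support (h p) \<in> K"
      using complex_onD(3)[OF K carrier[OF x]] by blast
    then show "h p \<in> topspace (geometric_realization K)"
      unfolding topspace_geometric_realization[OF K] using sum1 F(1) G(1) s by (auto simp: h_def)
  qed
  then show ?thesis
    unfolding homotopic_with_def by (intro exI[of _ h]) (auto simp: h_def)
qed

section \<open>Simplicial maps between realizations\<close>

definition pushforward :: "'v set \<Rightarrow> ('v \<Rightarrow> 'w) \<Rightarrow> ('v \<Rightarrow> real) \<Rightarrow> 'w \<Rightarrow> real" where
  "pushforward V r f w = (\<Sum>v | v \<in> V \<and> r v = w. f v)"

lemma support_pushforward:
  assumes "finite V" "\<And>v. 0 \<le> f v" "support f \<subseteq> V"
  shows "support (pushforward V r f) = r ` support f"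
proof -
  have "pushforward V r f w = 0 \<longleftrightarrow> (\<forall>v. v \<in> V \<and> r v = w \<longrightarrow> f v = 0)" for w
    unfolding pushforward_def using assms by (subst sum_nonneg_eq_0_iff) auto
  then show ?thesis using assms(3) by (fastforce simp: support_def)
qed

text \<open>For a simplicial \<open>r\<close> the pushforward of a point has total weight 1 already,
  so the normalization changes nothing there; it makes the general facts on
  \<open>normalize_weights\<close> applicable without computing this total.\<close>

definition simplicial_map_realization ::
  "'v set \<Rightarrow> 'w set \<Rightarrow> ('v \<Rightarrow> 'w) \<Rightarrow> ('v \<Rightarrow> real) \<Rightarrow> 'w \<Rightarrow> real" where
  "simplicial_map_realization V W r f = normalize_weights W (pushforward V r f)"

lemma simplicial_map_realization:
  assumes K: "complex_on V K" and L: "complex_on W L" and r: "\<And>\<sigma>. \<sigma> \<in> K \<Longrightarrow> r ` \<sigma> \<in> L"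
  shows "continuous_map (geometric_realization K) (geometric_realization L)
           (simplicial_map_realization V W r)"
    and "f \<in> topspace (geometric_realization K) \<Longrightarrow>
           support (simplicial_map_realization V W r f) = r ` support f"
proof -
  have supp: "support (pushforward V r f) = r ` support f"
    if "f \<in> topspace (geometric_realization K)" for f
    using in_geometric_realizationD[OF K that] complex_onD[OF K] by (intro support_pushforward) auto
  have nn: "0 \<le> pushforward V r f w" if "f \<in> topspace (geometric_realization K)" for f w
    unfolding pushforward_def using in_geometric_realizationD[OF K that] by (intro sum_nonneg) auto
  show "continuous_map (geometric_realization K) (geometric_realization L)
           (simplicial_map_realization V W r)"
    unfolding simplicial_map_realization_def
  proof (rule continuous_map_normalize_weights[OF L])
    show "continuous_map (geometric_realization K) euclideanreal (\<lambda>f. pushforward V r f w)" for w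
      unfolding pushforward_def using complex_onD(1)[OF K] by (intro continuous_intros) auto
  qed (use supp nn r in_geometric_realizationD[OF K] in auto)
  show "support (simplicial_map_realization V W r f) = r ` support f"
    if f: "f \<in> topspace (geometric_realization K)"
    unfolding simplicial_map_realization_def
    using normalize_weights_in_realization(2)[OF L nn[OF f]] supp[OF f] r in_geometric_realizationD[OF K f]
    by auto
qed

text \<open>The composites are contiguous to the identities: a point with support \<sigma> and its
  image both live on the simplex \<open>q\<close> r \<open>\<sigma> \<union> \<sigma>\<close>.
  Foldings and isomorphisms of complexes are both instances.\<close>

lemma homotopy_equivalent_contiguous:
  assumes K: "complex_on V K" and L: "complex_on W L"
    and r: "\<And>\<sigma>. \<sigma> \<in> K \<Longrightarrow> r ` \<sigma> \<in> L" and q: "\<And>\<tau>. \<tau> \<in> L \<Longrightarrow> q ` \<tau> \<in> K"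
    and qr: "\<And>\<sigma>. \<sigma> \<in> K \<Longrightarrow> q ` r ` \<sigma> \<union> \<sigma> \<in> K"
    and rq: "\<And>\<tau>. \<tau> \<in> L \<Longrightarrow> r ` q ` \<tau> \<union> \<tau> \<in> L"
  shows "geometric_realization K homotopy_equivalent_space geometric_realization L"
proof -
  let ?r = "simplicial_map_realization V W r" and ?q = "simplicial_map_realization W V q"
  note R = simplicial_map_realization[OF K L r] and Q = simplicial_map_realization[OF L K q]
  have "homotopic_with (\<lambda>_. True) (geometric_realization K) (geometric_realization K) (?q \<circ> ?r) id"
  proof (rule homotopic_with_common_carrier[OF K])
    fix f assume f: "f \<in> topspace (geometric_realization K)"
    then have "?r f \<in> topspace (geometric_realization L)"
      using R(1) continuous_map_image_subset_topspace by blast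
    then show "support ((?q \<circ> ?r) f) \<union> support (id f) \<in> K"
      using Q(2) R(2)[OF _ f] qr in_geometric_realizationD(2)[OF K f] by simp
  qed (use R(1) Q(1) continuous_map_compose in auto)
  moreover have "homotopic_with (\<lambda>_. True) (geometric_realization L) (geometric_realization L) (?r \<circ> ?q) id"
  proof (rule homotopic_with_common_carrier[OF L])
    fix f assume f: "f \<in> topspace (geometric_realization L)"
    then have "?q f \<in> topspace (geometric_realization K)"
      using Q(1) continuous_map_image_subset_topspace by blast
    then show "support ((?r \<circ> ?q) f) \<union> support (id f) \<in> L"
      using R(2) Q(2)[OF _ f] rq in_geometric_realizationD(2)[OF L f] by simp
  qed (use R(1) Q(1) continuous_map_compose in auto)
  ultimately show ?thesis
    unfolding homotopy_equivalent_space_def using R(1) Q(1) by blast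
qed

section \<open>Independence complexes\<close>

definition ind_complex :: "'v set \<Rightarrow> ('v \<Rightarrow> 'v \<Rightarrow> bool) \<Rightarrow> 'v set set" where
  "ind_complex V E = {\<sigma>. \<sigma> \<noteq> {} \<and> \<sigma> \<subseteq> V \<and> (\<forall>x\<in>\<sigma>. \<forall>y\<in>\<sigma>. \<not> E x y)}"

lemma complex_on_ind_complex: "finite V \<Longrightarrow> complex_on V (ind_complex V E)"
  unfolding complex_on_def ind_complex_def by blast

text \<open>The retraction sends each \<open>b\<close> to a vertex \<open>d b\<close> all of whose
  neighbours are neighbours of \<open>b\<close>, so putting \<open>d b\<close> next to
  \<open>b\<close> or in its place creates no conflict, and the retraction is contiguous to the
  identity. A whole set \<open>B\<close> can be removed at once because the vertices
  \<open>d b\<close> lie outside \<open>B\<close>.\<close>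

lemma ind_complex_fold:
  assumes "finite V" and sym: "\<And>x y. E x y \<Longrightarrow> E y x"
    and dom: "\<And>b. b \<in> B \<Longrightarrow> b \<in> V \<Longrightarrow> \<exists>a\<in>V - B. \<forall>x\<in>V. E a x \<longrightarrow> E b x"
  shows "geometric_realization (ind_complex V E) homotopy_equivalent_space
         geometric_realization (ind_complex (V - B) E)"
proof -
  obtain d where d: "\<And>b. b \<in> B \<Longrightarrow> b \<in> V \<Longrightarrow> d b \<in> V - B \<and> (\<forall>x\<in>V. E (d b) x \<longrightarrow> E b x)"
    using dom by metis
  define r where "r x = (if x \<in> B then d x else x)" for x
  have r: "r x \<in> V - B" "E (r x) y \<Longrightarrow> E x y" if "x \<in> V" "y \<in> V" for x y
    using d[of x] that by (auto simp: r_def split: if_splits)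
  \<comment> \<open>A conflict is pulled back from \<open>r x\<close> to \<open>x\<close> one
    argument at a time, with symmetry to exchange the arguments.\<close>
  have rr: "\<not> E (r x) (r y) \<and> \<not> E (r x) y \<and> \<not> E y (r x)"
    if "\<sigma> \<in> ind_complex V E" "x \<in> \<sigma>" "y \<in> \<sigma>" for \<sigma> x y
  proof -
    have "x \<in> V" "y \<in> V" "\<not> E x y" "\<not> E y x" using that by (auto simp: ind_complex_def)
    then show ?thesis using r[of x y] r[of y x] r[of x "r y"] sym by blast
  qed
  show ?thesis
  proof (rule homotopy_equivalent_contiguous[of V _ "V - B" _ r id])
    fix \<sigma> assume s: "\<sigma> \<in> ind_complex V E"
    then have sub: "\<sigma> \<subseteq> V" "\<sigma> \<noteq> {}" and ind: "\<forall>x\<in>\<sigma>. \<forall>y\<in>\<sigma>. \<not> E x y" by (auto simp: ind_complex_def)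
    have rs: "r ` \<sigma> \<subseteq> V - B" using sub r(1) by blast
    show "r ` \<sigma> \<in> ind_complex (V - B) E"
      using rs sub rr[OF s] by (auto simp: ind_complex_def)
    show "id ` r ` \<sigma> \<union> \<sigma> \<in> ind_complex V E"
      using rs sub rr[OF s] ind by (auto simp: ind_complex_def)
  next
    fix \<tau> assume t: "\<tau> \<in> ind_complex (V - B) E"
    then have "r ` \<tau> = \<tau>" by (force simp: ind_complex_def r_def)
    with t show "r ` id ` \<tau> \<union> \<tau> \<in> ind_complex (V - B) E" "id ` \<tau> \<in> ind_complex V E"
      by (auto simp: ind_complex_def)
  qed (simp_all add: complex_on_ind_complex \<open>finite V\<close>)
qed

lemma homotopy_equivalent_isomorphic:
  assumes K: "complex_on V K" and L: "complex_on W L" and bij: "bij_betw r V W"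
    and iso: "\<And>\<sigma>. \<sigma> \<subseteq> V \<Longrightarrow> \<sigma> \<in> K \<longleftrightarrow> r ` \<sigma> \<in> L"
  shows "geometric_realization K homotopy_equivalent_space geometric_realization L"
proof -
  let ?q = "inv_into V r"
  have qr: "?q ` r ` \<sigma> = \<sigma>" if "\<sigma> \<subseteq> V" for \<sigma>
    using bij that by (simp add: bij_betw_def inv_into_image_cancel)
  have rq: "r ` ?q ` \<tau> = \<tau>" if "\<tau> \<subseteq> W" for \<tau>
    using bij that by (simp add: bij_betw_def image_inv_into_cancel)
  have qW: "?q ` \<tau> \<subseteq> V" if "\<tau> \<subseteq> W" for \<tau>
    using bij that by (metis bij_betw_def image_mono inv_into_image_cancel subset_refl)
  show ?thesis
  proof (rule homotopy_equivalent_contiguous[OF K L, of r ?q])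
    fix \<sigma> assume "\<sigma> \<in> K"
    with complex_onD(2)[OF K this] qr iso
    show "r ` \<sigma> \<in> L" "?q ` r ` \<sigma> \<union> \<sigma> \<in> K" by simp_all
  next
    fix \<tau> assume "\<tau> \<in> L"
    with complex_onD(2)[OF L this] rq qW iso
    show "?q ` \<tau> \<in> K" "r ` ?q ` \<tau> \<union> \<tau> \<in> L" by simp_all
  qed
qed

lemma ind_complex_isomorphic:
  assumes fin: "finite V" and bij: "bij_betw r V W"
    and iso: "\<And>x y. x \<in> V \<Longrightarrow> y \<in> V \<Longrightarrow> E' (r x) (r y) \<longleftrightarrow> E x y"
  shows "geometric_realization (ind_complex V E) homotopy_equivalent_space
         geometric_realization (ind_complex W E')"
proof (rule homotopy_equivalent_isomorphic[OF complex_on_ind_complex complex_on_ind_complex bij])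
  have W: "W = r ` V" using bij by (simp add: bij_betw_def)
  then show "finite W" using fin by simp
  fix \<sigma> assume "\<sigma> \<subseteq> V"
  then show "\<sigma> \<in> ind_complex V E \<longleftrightarrow> r ` \<sigma> \<in> ind_complex W E'"
    using iso unfolding ind_complex_def W by (auto simp: subset_iff)
qed (rule fin)

section \<open>Wedges of copies of a space\<close>

lemma continuous_map_wedge_inj:
  "i < k \<Longrightarrow> continuous_map X (wedge_copies k X p) (wedge_inj p i)"
  by (auto simp: continuous_map_def topspace_wedge_copies openin_wedge_copies)

lemma wedge_copies_cases:
  assumes "w \<in> topspace (wedge_copies k X p)" "p \<in> topspace X" "0 < k"
  obtains i x where "i < k" "x \<in> topspace X" "w = wedge_inj p i x"
proof (cases "w = None")
  case True
  then show ?thesis using that[of 0 p] assms by (simp add: wedge_inj_def)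
next
  case False
  then show ?thesis using that assms by (auto simp: topspace_wedge_copies)
qed

text \<open>The universal property of the final topology. The base point needs its own assumption
  because for \<open>k = 0\<close> no copy controls its image.\<close>

lemma continuous_map_from_wedge:
  assumes "h None \<in> topspace Y" "\<And>i. i < k \<Longrightarrow> continuous_map X Y (\<lambda>x. h (wedge_inj p i x))"
  shows "continuous_map (wedge_copies k X p) Y h"
  unfolding continuous_map_def
proof (intro conjI allI impI)
  show "h \<in> topspace (wedge_copies k X p) \<rightarrow> topspace Y"
    using assms by (auto simp: topspace_wedge_copies continuous_map_def)
  fix U assume U: "openin Y U"
  have "openin X {x \<in> topspace X. wedge_inj p i x \<in> {w \<in> topspace (wedge_copies k X p). h w \<in> U}}"
    if "i < k" for i
  proof -
    have "{x \<in> topspace X. wedge_inj p i x \<in> {w \<in> topspace (wedge_copies k X p). h w \<in> U}}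
        = {x \<in> topspace X. h (wedge_inj p i x) \<in> U}"
      using that by (auto simp: topspace_wedge_copies)
    then show ?thesis
      using openin_continuous_map_preimage[OF assms(2)[OF that] U] by simp
  qed
  then show "openin (wedge_copies k X p) {w \<in> topspace (wedge_copies k X p). h w \<in> U}"
    using topspace_wedge_copies[of k X p] by (auto simp: openin_wedge_copies)
qed

definition wedge_proj :: "'a \<Rightarrow> nat \<Rightarrow> (nat \<times> 'a) option \<Rightarrow> 'a" where
  "wedge_proj p i w = (case w of None \<Rightarrow> p | Some (j, x) \<Rightarrow> if j = i then x else p)"

lemma wedge_proj_inj: "wedge_proj p i (wedge_inj p j x) = (if j = i then x else p)"
  by (simp add: wedge_proj_def wedge_inj_def)

lemma continuous_map_wedge_proj:
  assumes "p \<in> topspace X"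
  shows "continuous_map (wedge_copies k X p) X (wedge_proj p i)"
proof (rule continuous_map_from_wedge)
  show "continuous_map X X (\<lambda>x. wedge_proj p i (wedge_inj p j x))" for j
    using assms by (cases "j = i") (simp_all add: wedge_proj_inj)
qed (simp add: wedge_proj_def assms)

text \<open>In every other copy the complement shows up as \<open>X\<close> without the base point,
  which is open because \<open>{p}\<close> is closed; in the copy itself it is empty. The copies
  thus form a finite closed cover.\<close>

lemma closedin_wedge_copy:
  assumes "closedin X {p}" "i < k"
  shows "closedin (wedge_copies k X p) (wedge_inj p i ` topspace X)"
proof -
  have p: "p \<in> topspace X" using assms(1) closedin_subset by fastforce
  have "openin X {x \<in> topspace X. wedge_inj p j x \<in>
      topspace (wedge_copies k X p) - wedge_inj p i ` topspace X}" if "j < k" for j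
  proof (cases "j = i")
    case True
    then have "{x \<in> topspace X. wedge_inj p j x \<in>
      topspace (wedge_copies k X p) - wedge_inj p i ` topspace X} = {}" by auto
    then show ?thesis by (simp only: openin_empty)
  next
    case False
    have "wedge_inj p j x \<in> wedge_inj p i ` topspace X \<longleftrightarrow> x = p" if "x \<in> topspace X" for x
      using False that p by (auto simp: wedge_inj_def image_iff)
    then have "{x \<in> topspace X. wedge_inj p j x \<in>
      topspace (wedge_copies k X p) - wedge_inj p i ` topspace X} = topspace X - {p}"
      using \<open>j < k\<close> by (auto simp: topspace_wedge_copies)
    then show ?thesis using assms(1) by (simp only: closedin_def)
  qed
  then have "openin (wedge_copies k X p) (topspace (wedge_copies k X p) - wedge_inj p i ` topspace X)"
    unfolding openin_wedge_copies[of k X p "topspace _ - _"] by (auto simp: topspace_wedge_copies)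
  then show ?thesis
    using assms(2) by (auto simp: closedin_def topspace_wedge_copies)
qed

text \<open>A product with \<open>Z\<close> need not carry the final topology of its pieces, so the
  universal property of the wedge does not apply directly. The proof pastes along the finite closed
  cover by \<open>Z\<close> times the copies; on each piece \<open>h\<close> factors through the
  retraction \<open>wedge_proj\<close> onto that copy.\<close>

lemma continuous_map_prod_wedge:
  assumes p: "closedin X {p}" and "0 < k"
    and cont: "\<And>i. i < k \<Longrightarrow> continuous_map (prod_topology Z X) Y (\<lambda>(z, x). h (z, wedge_inj p i x))"
  shows "continuous_map (prod_topology Z (wedge_copies k X p)) Y h"
proof (rule pasting_lemma_closed[where I = "{..<k}" and f = "\<lambda>_. h"
      and T = "\<lambda>i. topspace Z \<times> wedge_inj p i ` topspace X"])
  have pX: "p \<in> topspace X" using p closedin_subset by fastforce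
  fix i assume "i \<in> {..<k}"
  then have i: "i < k" by simp
  show "closedin (prod_topology Z (wedge_copies k X p)) (topspace Z \<times> wedge_inj p i ` topspace X)"
    using closedin_wedge_copy[OF p i] by (simp add: closedin_prod_Times_iff)
  have "continuous_map (prod_topology Z (wedge_copies k X p)) (prod_topology Z X)
      (\<lambda>x. (fst x, wedge_proj p i (snd x)))"
    using continuous_map_compose[OF continuous_map_snd continuous_map_wedge_proj[OF pX]]
    by (intro continuous_map_pairedI continuous_map_fst) (simp add: o_def)
  then have "continuous_map (prod_topology Z (wedge_copies k X p)) Y
      (\<lambda>x. h (fst x, wedge_inj p i (wedge_proj p i (snd x))))"
    using continuous_map_compose[OF _ cont[OF i], of _ "\<lambda>x. (fst x, wedge_proj p i (snd x))"]
    by (simp add: o_def)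
  then show "continuous_map (subtopology (prod_topology Z (wedge_copies k X p))
      (topspace Z \<times> wedge_inj p i ` topspace X)) Y h"
    by (rule continuous_map_eq[OF continuous_map_from_subtopology]) (auto simp: wedge_proj_inj)
next
  have "p \<in> topspace X" using p closedin_subset by fastforce
  then show "\<exists>j. j \<in> {..<k} \<and> x \<in> topspace Z \<times> wedge_inj p j ` topspace X \<and> h x = h x"
    if "x \<in> topspace (prod_topology Z (wedge_copies k X p))" for x
    using that wedge_copies_cases[of "snd x" k X p] \<open>0 < k\<close>
    by (metis image_eqI lessThan_iff mem_Times_iff topspace_prod_topology)
qed auto

lemma wedge_copies_one: 
  assumes "p \<in> topspace X"
  shows "wedge_copies 1 X p homeomorphic_space X"
proof -
  have "wedge_inj p 0 (wedge_proj p 0 w) = w" if "w \<in> topspace (wedge_copies 1 X p)" for w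
    using wedge_copies_cases[OF that assms] by (metis less_one wedge_proj_inj zero_less_one)
  then have "homeomorphic_maps (wedge_copies 1 X p) X (wedge_proj p 0) (wedge_inj p 0)"
    using assms unfolding homeomorphic_maps_def
    by (simp add: continuous_map_wedge_inj continuous_map_wedge_proj wedge_proj_inj)
  then show ?thesis unfolding homeomorphic_space_def by blast
qed

lemma sphere_wedge_one: "sphere_wedge 1 d homeomorphic_space nsphere d"
  unfolding sphere_wedge_def by (rule wedge_copies_one[OF sphere_base_in_nsphere])

section \<open>Normalization to the unit sphere\<close>

text \<open>Radial projection, in the encoding of \<open>nsphere d\<close> by sequences that vanish
  beyond index \<open>d\<close>. At the origin it takes the value 0, off the sphere, so every use
  comes with a proof that some coordinate is nonzero.\<close>

definition unit_vector :: "nat \<Rightarrow> (nat \<Rightarrow> real) \<Rightarrow> nat \<Rightarrow> real" where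
  "unit_vector d x i = (if i \<le> d then x i / sqrt (\<Sum>i\<le>d. (x i)\<^sup>2) else 0)"

lemma sum_squares_pos:
  fixes x :: "nat \<Rightarrow> real"
  assumes "\<exists>i\<le>d. x i \<noteq> 0"
  shows "0 < (\<Sum>i\<le>d. (x i)\<^sup>2)"
proof -
  obtain i where "i \<le> d" "x i \<noteq> 0" using assms by blast
  then show ?thesis by (intro sum_pos2[of _ i]) auto
qed

lemma unit_vector_in_nsphere:
  assumes "\<exists>i\<le>d. x i \<noteq> 0"
  shows "unit_vector d x \<in> topspace (nsphere d)"
proof -
  have "(\<Sum>i\<le>d. (unit_vector d x i)\<^sup>2) = (\<Sum>i\<le>d. (x i)\<^sup>2 / (\<Sum>i\<le>d. (x i)\<^sup>2))"
    by (rule sum.cong) (auto simp: unit_vector_def power_divide sum_nonneg)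
  then show ?thesis
    using sum_squares_pos[OF assms] by (simp add: nsphere unit_vector_def flip: sum_divide_distrib)
qed

lemma unit_vector_of_nsphere: "x \<in> topspace (nsphere d) \<Longrightarrow> unit_vector d x = x"
  by (auto simp: nsphere unit_vector_def fun_eq_iff)

lemma nsphere_nonzero: "x \<in> topspace (nsphere d) \<Longrightarrow> \<exists>i\<le>d. x i \<noteq> 0"
  by (rule ccontr) (simp add: nsphere)

lemma continuous_map_unit_vector:
  assumes "\<And>i. i \<le> d \<Longrightarrow> continuous_map X euclideanreal (\<lambda>p. x p i)"
    and "\<And>p. p \<in> topspace X \<Longrightarrow> \<exists>i\<le>d. x p i \<noteq> 0"
  shows "continuous_map X (nsphere d) (\<lambda>p. unit_vector d (x p))"
proof -
  have "continuous_map X euclideanreal (\<lambda>p. unit_vector d (x p) i)" for i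
  proof (cases "i \<le> d")
    case True
    have "continuous_map X euclideanreal (\<lambda>p. sqrt (\<Sum>i\<le>d. (x p i)\<^sup>2))"
      using continuous_map_compose[OF continuous_map_sum continuous_map_square_root,
          of "{..d}" X "\<lambda>p i. (x p i)\<^sup>2"] assms(1)
      by (simp add: o_def continuous_map_real_pow)
    moreover have "sqrt (\<Sum>i\<le>d. (x p i)\<^sup>2) \<noteq> 0" if "p \<in> topspace X" for p
      using sum_squares_pos[OF assms(2)[OF that]] by simp
    ultimately show ?thesis
      unfolding unit_vector_def using True assms(1)[OF True] by (simp add: continuous_map_real_divide)
  qed (simp add: unit_vector_def)
  then show ?thesis
    using unit_vector_in_nsphere[OF assms(2)] unfolding nsphere
    by (auto simp: continuous_map_in_subtopology continuous_map_componentwise_UNIV Pi_iff)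
qed

lemma closedin_nsphere_base: "closedin (nsphere d) {sphere_base}"
proof -
  have "Hausdorff_space (nsphere d)"
    unfolding nsphere by (simp add: Hausdorff_space_subtopology Hausdorff_space_product_topology)
  then show ?thesis
    by (rule closedin_Hausdorff_singleton[OF _ sphere_base_in_nsphere])
qed

section \<open>The join of a cross-polytope boundary with finitely many points\<close>

datatype cross_vertex = Pos nat | Neg nat | Apex nat

text \<open>\<open>d\<close> antipodal pairs span a (d-1)-sphere. There are \<open>k + 1\<close>
  apexes, one more than the spheres in the wedge: \<open>Apex 0\<close> spans the cone that is
  collapsed.\<close>

definition cross_verts :: "nat \<Rightarrow> nat \<Rightarrow> cross_vertex set" where
  "cross_verts d k = Pos ` {1..d} \<union> Neg ` {1..d} \<union> Apex ` {..k}"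

definition cross_complex :: "nat \<Rightarrow> nat \<Rightarrow> cross_vertex set set" where
  "cross_complex d k = {\<sigma>. \<sigma> \<noteq> {} \<and> \<sigma> \<subseteq> cross_verts d k \<and>
     (\<forall>i. \<not> (Pos i \<in> \<sigma> \<and> Neg i \<in> \<sigma>)) \<and> (\<forall>i j. Apex i \<in> \<sigma> \<and> Apex j \<in> \<sigma> \<longrightarrow> i = j)}"

lemma complex_on_cross_complex: "complex_on (cross_verts d k) (cross_complex d k)"
  unfolding complex_on_def
proof (intro conjI ballI allI impI)
  fix \<sigma> \<tau> assume "\<sigma> \<in> cross_complex d k" "\<tau> \<subseteq> \<sigma> \<and> \<tau> \<noteq> {}"
  then show "\<tau> \<in> cross_complex d k"
    unfolding cross_complex_def mem_Collect_eq by (meson subset_iff subset_trans)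
qed (auto simp: cross_verts_def cross_complex_def)

lemma realization_single_support:
  assumes K: "complex_on V K" and f: "f \<in> topspace (geometric_realization K)" and "support f \<subseteq> {v}"
  shows "f v = 1"
proof -
  have "support f = {v}" using assms in_geometric_realizationD(4)[OF K f] by blast
  then have "v \<in> V" "\<And>x. x \<noteq> v \<Longrightarrow> f x = 0"
    using in_geometric_realizationD(2)[OF K f] complex_onD(2)[OF K] by (auto simp: support_def)
  then have "sum f V = f v"
    using complex_onD(1)[OF K] by (subst sum.remove[of V v]) (auto intro: sum.neutral)
  then show ?thesis using in_geometric_realizationD(3)[OF K f] by simp
qed

lemma cross_realizationD:
  assumes "f \<in> topspace (geometric_realization (cross_complex d k))"
  shows "f (Pos i) = 0 \<or> f (Neg i) = 0" "f (Apex i) \<noteq> 0 \<Longrightarrow> f (Apex j) \<noteq> 0 \<Longrightarrow> i = j"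
    "f v \<noteq> 0 \<Longrightarrow> v \<in> cross_verts d k"
proof -
  have "support f \<in> cross_complex d k"
    by (rule in_geometric_realizationD(2)[OF complex_on_cross_complex assms])
  then show "f (Pos i) = 0 \<or> f (Neg i) = 0" "f (Apex i) \<noteq> 0 \<Longrightarrow> f (Apex j) \<noteq> 0 \<Longrightarrow> i = j"
    "f v \<noteq> 0 \<Longrightarrow> v \<in> cross_verts d k"
    by (auto simp: cross_complex_def support_def subset_iff)
qed

lemma Pos_Neg_in_cross_verts [simp]:
  "Pos i \<in> cross_verts d k \<longleftrightarrow> 1 \<le> i \<and> i \<le> d" "Neg i \<in> cross_verts d k \<longleftrightarrow> 1 \<le> i \<and> i \<le> d"
  "Apex j \<in> cross_verts d k \<longleftrightarrow> j \<le> k"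
  by (auto simp: cross_verts_def)

text \<open>With s the weight of \<open>Apex j\<close>, coordinate 0 runs from 1 at the base of the
  cone to -1 at its apex. The factor s in the other coordinates sends all points with s = 0 to the
  single vector \<open>sphere_base\<close>, so the formula makes sense on the whole complex and not
  only on this cone.\<close>

definition cone_vector :: "nat \<Rightarrow> (cross_vertex \<Rightarrow> real) \<Rightarrow> nat \<Rightarrow> real" where
  "cone_vector j f i =
     (if i = 0 then 1 - 2 * f (Apex j) else f (Apex j) * (f (Pos i) - f (Neg i)))"

text \<open>Collapses the base of the cone with apex \<open>j\<close> to the base point of the sphere.\<close>

definition cone_collapse :: "nat \<Rightarrow> nat \<Rightarrow> (cross_vertex \<Rightarrow> real) \<Rightarrow> nat \<Rightarrow> real" where
  "cone_collapse d j f = unit_vector d (cone_vector j f)"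

text \<open>A zero in coordinate 0 forces weight 1/2 at \<open>Apex j\<close>. Then all differences
  of antipodal weights vanish, and with them the weights themselves, as only one of each pair can be
  nonzero. All mass would sit at \<open>Apex j\<close>, with weight 1.\<close>

lemma cone_vector_nonzero:
  assumes f: "f \<in> topspace (geometric_realization (cross_complex d k))"
  shows "\<exists>i\<le>d. cone_vector j f i \<noteq> 0"
proof (rule ccontr)
  assume "\<not> ?thesis"
  then have z: "\<And>i. i \<le> d \<Longrightarrow> cone_vector j f i = 0" by blast
  have s: "f (Apex j) = 1 / 2" using z[of 0] by (simp add: cone_vector_def)
  note F = cross_realizationD[OF f]
  have "f v = 0" if "v \<noteq> Apex j" for v
  proof (cases v)
    case (Apex i)
    then show ?thesis using F(2)[of i j] s that by auto
  next
    case (Pos i)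
    show ?thesis
    proof (rule ccontr)
      assume nz: "f v \<noteq> 0"
      then have "f (Neg i) = 0" "1 \<le> i \<and> i \<le> d"
        using F(1)[of i] F(3)[of v] Pos by auto
      then show False using z[of i] s nz Pos by (simp add: cone_vector_def)
    qed
  next
    case (Neg i)
    show ?thesis
    proof (rule ccontr)
      assume nz: "f v \<noteq> 0"
      then have "f (Pos i) = 0" "1 \<le> i \<and> i \<le> d"
        using F(1)[of i] F(3)[of v] Neg by auto
      then show False using z[of i] s nz Neg by (simp add: cone_vector_def)
    qed
  qed
  then have "f (Apex j) = 1"
    by (intro realization_single_support[OF complex_on_cross_complex f]) (auto simp: support_def)
  with s show False by simp
qed

lemma continuous_map_cone_collapse:
  "continuous_map (geometric_realization (cross_complex d k)) (nsphere d) (cone_collapse d j)"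
  unfolding cone_collapse_def
proof (rule continuous_map_unit_vector)
  show "continuous_map (geometric_realization (cross_complex d k)) euclideanreal
          (\<lambda>f. cone_vector j f i)" for i
    unfolding cone_vector_def by (cases "i = 0") (auto intro!: continuous_intros)
qed (rule cone_vector_nonzero)

lemma cone_collapse_base:
  assumes "f (Apex j) = 0"
  shows "cone_collapse d j f = sphere_base"
proof -
  have "cone_vector j f = sphere_base"
    using assms by (simp add: cone_vector_def sphere_base_def fun_eq_iff)
  then show ?thesis
    unfolding cone_collapse_def using unit_vector_of_nsphere[OF sphere_base_in_nsphere] by simp
qed

text \<open>The cone over \<open>Apex 0\<close>, which includes the common base of all cones, goes
  to the base point. The cone over \<open>Apex j\<close> for j from 1 to \<open>k\<close> fills copy
  \<open>j - 1\<close>, as copies are counted from 0.\<close>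

definition to_wedge :: "nat \<Rightarrow> nat \<Rightarrow> (cross_vertex \<Rightarrow> real) \<Rightarrow> (nat \<times> (nat \<Rightarrow> real)) option" where
  "to_wedge d k f = (if \<forall>i\<in>{1..k}. f (Apex i) = 0 then None
     else let j = (THE j. j \<in> {1..k} \<and> f (Apex j) \<noteq> 0)
          in wedge_inj sphere_base (j - 1) (cone_collapse d j f))"

lemma to_wedge_cone:
  assumes j: "j \<in> {1..k}" and other: "\<And>i. i \<in> {1..k} - {j} \<Longrightarrow> f (Apex i) = 0"
  shows "to_wedge d k f = wedge_inj sphere_base (j - 1) (cone_collapse d j f)"
proof (cases "f (Apex j) = 0")
  case True
  then have "\<forall>i\<in>{1..k}. f (Apex i) = 0" using other by blast
  then show ?thesis
    using cone_collapse_base[of f j d, OF True] by (simp add: to_wedge_def wedge_inj_def)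
next
  case False
  then have "(THE j. j \<in> {1..k} \<and> f (Apex j) \<noteq> 0) = j"
    using j other by (intro the_equality) auto
  then show ?thesis using j False by (auto simp: to_wedge_def)
qed

text \<open>The pieces are the closed sets where every apex from 1 to \<open>k\<close> other than
  \<open>j\<close> has weight 0. There the cone formula for \<open>j\<close> is valid even if
  \<open>Apex j\<close> has weight 0 too, since it then gives the base point, so the choice of the
  apex disappears. Index 0 is the constant piece, which is the entire cover for
  \<open>k = 0\<close>.\<close>

lemma continuous_map_to_wedge:
  "continuous_map (geometric_realization (cross_complex d k)) (sphere_wedge k d) (to_wedge d k)"
proof (rule pasting_lemma_closed[where I = "{0..k}" and f = "\<lambda>_. to_wedge d k"
      and T = "\<lambda>j. {f \<in> topspace (geometric_realization (cross_complex d k)).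
                     \<forall>i\<in>{1..k} - {j}. f (Apex i) = 0}"])
  let ?X = "geometric_realization (cross_complex d k)"
  fix j assume j: "j \<in> {0..k}"
  let ?T = "{f \<in> topspace ?X. \<forall>i\<in>{1..k} - {j}. f (Apex i) = 0}"
  have "closedin ?X {f \<in> topspace ?X. f (Apex i) \<in> {0}}" for i
    by (rule closedin_continuous_map_preimage[OF continuous_map_realization_coordinate]) simp
  then have "closedin ?X (\<Inter>(insert (topspace ?X)
      ((\<lambda>i. {f \<in> topspace ?X. f (Apex i) \<in> {0}}) ` ({1..k} - {j}))))"
    by (intro closedin_Inter) auto
  moreover have "?T = \<Inter>(insert (topspace ?X)
      ((\<lambda>i. {f \<in> topspace ?X. f (Apex i) \<in> {0}}) ` ({1..k} - {j})))"
    by auto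
  ultimately show "closedin ?X ?T" by (simp only:)
  show "continuous_map (subtopology ?X ?T) (sphere_wedge k d) (to_wedge d k)"
  proof (cases "j = 0")
    case True
    have "continuous_map (subtopology ?X ?T) (sphere_wedge k d) (\<lambda>_. None)"
      by (simp add: sphere_wedge_def topspace_wedge_copies)
    then show ?thesis
      by (rule continuous_map_eq) (use True in \<open>auto simp: to_wedge_def\<close>)
  next
    case False
    with j have j': "j \<in> {1..k}" "j - 1 < k" by auto
    have "continuous_map ?X (sphere_wedge k d) (wedge_inj sphere_base (j - 1) \<circ> cone_collapse d j)"
      unfolding sphere_wedge_def
      using continuous_map_compose[OF continuous_map_cone_collapse continuous_map_wedge_inj[OF j'(2)]] .
    then show ?thesis
      by (rule continuous_map_eq[OF continuous_map_from_subtopology])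
        (use to_wedge_cone[OF j'(1)] in auto)
  qed
next
  fix f assume f: "f \<in> topspace (geometric_realization (cross_complex d k))"
  have one: "i = j" if "f (Apex i) \<noteq> 0" "f (Apex j) \<noteq> 0" for i j
    using cross_realizationD(2)[OF f] that .
  show "\<exists>j. j \<in> {0..k} \<and> f \<in> {f \<in> topspace (geometric_realization (cross_complex d k)).
                     \<forall>i\<in>{1..k} - {j}. f (Apex i) = 0} \<and> to_wedge d k f = to_wedge d k f"
  proof (cases "\<exists>j\<in>{1..k}. f (Apex j) \<noteq> 0")
    case True
    then obtain j where "j \<in> {1..k}" "f (Apex j) \<noteq> 0" by blast
    moreover have "\<forall>i\<in>{1..k} - {j}. f (Apex i) = 0"
      using one \<open>f (Apex j) \<noteq> 0\<close> by blast
    ultimately show ?thesis using f by (intro exI[of _ j]) simp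
  next
    case False
    then show ?thesis using f by (intro exI[of _ 0]) simp
  qed
qed auto

text \<open>The octahedral coordinates of a sphere: positive and negative parts of each coordinate
  become the weights of two antipodal vertices. For coordinate 0 these are \<open>Apex 0\<close>, at
  the base point of the sphere, and \<open>Apex (Suc i)\<close>, the apex belonging to copy
  \<open>i\<close>.\<close>

definition suspension_vector :: "nat \<Rightarrow> nat \<Rightarrow> (nat \<Rightarrow> real) \<Rightarrow> cross_vertex \<Rightarrow> real" where
  "suspension_vector d i x v = (case v of
     Pos m \<Rightarrow> if m \<in> {1..d} then max (x m) 0 else 0
   | Neg m \<Rightarrow> if m \<in> {1..d} then max (- x m) 0 else 0
   | Apex j \<Rightarrow> if j = 0 then max (x 0) 0 else if j = Suc i then max (- x 0) 0 else 0)"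

text \<open>The index 0 under \<open>None\<close> is arbitrary: at the base point all copies give
  the same weights, concentrated on \<open>Apex 0\<close>.\<close>

definition from_wedge :: "nat \<Rightarrow> nat \<Rightarrow> (nat \<times> (nat \<Rightarrow> real)) option \<Rightarrow> cross_vertex \<Rightarrow> real" where
  "from_wedge d k w = normalize_weights (cross_verts d k)
     (case w of None \<Rightarrow> suspension_vector d 0 sphere_base | Some (i, x) \<Rightarrow> suspension_vector d i x)"

lemma suspension_vector_base: "suspension_vector d i sphere_base = suspension_vector d j sphere_base"
  by (auto simp: suspension_vector_def sphere_base_def fun_eq_iff split: cross_vertex.split)

lemma from_wedge_inj:
  "from_wedge d k (wedge_inj sphere_base i x) = normalize_weights (cross_verts d k) (suspension_vector d i x)"
  using suspension_vector_base[of d i 0] by (simp add: from_wedge_def wedge_inj_def)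

lemma suspension_vector_nonneg: "0 \<le> suspension_vector d i x v"
  by (auto simp: suspension_vector_def split: cross_vertex.split)

lemma support_suspension_vector:
  assumes "x \<in> topspace (nsphere d)"
  shows "support (suspension_vector d i x) \<noteq> {}"
    and "i < k \<Longrightarrow> support (suspension_vector d i x) \<in> cross_complex d k"
proof -
  obtain m where m: "m \<le> d" "x m \<noteq> 0" using nsphere_nonzero[OF assms] by blast
  have "suspension_vector d i x
      (if m = 0 then (if x 0 > 0 then Apex 0 else Apex (Suc i))
       else if x m > 0 then Pos m else Neg m) \<noteq> 0"
    using m by (cases "m = 0") (auto simp: suspension_vector_def max_def)
  then show ne: "support (suspension_vector d i x) \<noteq> {}" unfolding support_def by blast
  have "v \<in> cross_verts d k" if "i < k" "suspension_vector d i x v \<noteq> 0" for v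
    using that by (cases v) (auto simp: suspension_vector_def cross_verts_def split: if_splits)
  moreover have "\<not> (suspension_vector d i x (Pos m) \<noteq> 0 \<and> suspension_vector d i x (Neg m) \<noteq> 0)" for m
    by (auto simp: suspension_vector_def max_def)
  moreover have "a = b"
    if "suspension_vector d i x (Apex a) \<noteq> 0 \<and> suspension_vector d i x (Apex b) \<noteq> 0" for a b
    using that by (auto simp: suspension_vector_def max_def split: if_splits)
  ultimately show "i < k \<Longrightarrow> support (suspension_vector d i x) \<in> cross_complex d k"
    using ne unfolding cross_complex_def support_def by blast
qed

lemma suspension_in_realization:
  assumes "x \<in> topspace (nsphere d)" "i < k"
  shows "normalize_weights (cross_verts d k) (suspension_vector d i x)
           \<in> topspace (geometric_realization (cross_complex d k))"
    and "support (normalize_weights (cross_verts d k) (suspension_vector d i x))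
           = support (suspension_vector d i x)"
  by (rule normalize_weights_in_realization[OF complex_on_cross_complex suspension_vector_nonneg
      support_suspension_vector(2)[OF assms] support_suspension_vector(1)[OF assms(1)]])+

lemma continuous_map_suspension:
  assumes "i < k"
  shows "continuous_map (nsphere d) (geometric_realization (cross_complex d k))
           (\<lambda>x. normalize_weights (cross_verts d k) (suspension_vector d i x))"
proof (rule continuous_map_normalize_weights[OF complex_on_cross_complex])
  note [continuous_intros] = continuous_map_nsphere_projection
  show "continuous_map (nsphere d) euclideanreal (\<lambda>x. suspension_vector d i x v)" for v
    unfolding suspension_vector_def
    by (cases v) (auto intro!: continuous_intros split: if_splits)
qed (simp_all add: support_suspension_vector assms suspension_vector_nonneg)

text \<open>Kept apart from \<open>suspension_in_realization\<close>, whose assumption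
  \<open>i < k\<close> leaves out the case \<open>k = 0\<close>.\<close>

lemma from_wedge_None: "from_wedge d k None \<in> topspace (geometric_realization (cross_complex d k))"
  and support_from_wedge_None: "support (from_wedge d k None) = {Apex 0}"
proof -
  have "support (suspension_vector d 0 sphere_base) = {Apex 0}"
    by (rule set_eqI, rename_tac v, case_tac v)
      (auto simp: support_def suspension_vector_def sphere_base_def)
  moreover have "{Apex 0} \<in> cross_complex d k"
    by (auto simp: cross_complex_def cross_verts_def)
  ultimately show "from_wedge d k None \<in> topspace (geometric_realization (cross_complex d k))"
      "support (from_wedge d k None) = {Apex 0}"
    using normalize_weights_in_realization[OF complex_on_cross_complex[of d k]
        suspension_vector_nonneg[of d 0 sphere_base]]
    by (auto simp: from_wedge_def)
qed

lemma continuous_map_from_sphere_wedge: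
  "continuous_map (sphere_wedge k d) (geometric_realization (cross_complex d k)) (from_wedge d k)"
  unfolding sphere_wedge_def
  by (rule continuous_map_from_wedge) (simp_all add: from_wedge_None from_wedge_inj continuous_map_suspension)

text \<open>A stopover between the identity and \<open>from_wedge\<close> after
  \<open>to_wedge\<close>. If an apex other than \<open>Apex 0\<close> has weight s with 0 < s <
  1/2, that composite gives weight to \<open>Apex 0\<close>, which lies in no simplex with the first
  apex, so a straight homotopy to the identity would leave the complex. The weight
  \<open>2s - 1\<close>, cut off at 0, vanishes up to s = 1/2, where coordinate 0 of
  \<open>cone_vector\<close> changes sign.\<close>

definition shrink_apex_vector :: "(cross_vertex \<Rightarrow> real) \<Rightarrow> cross_vertex \<Rightarrow> real" where
  "shrink_apex_vector f v =
     (case v of Apex j \<Rightarrow> if j = 0 then f v else max (2 * f v - 1) 0 | _ \<Rightarrow> f v)"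

lemma shrink_apex_vector_simps [simp]:
  "shrink_apex_vector f (Pos i) = f (Pos i)" "shrink_apex_vector f (Neg i) = f (Neg i)"
  "shrink_apex_vector f (Apex 0) = f (Apex 0)"
  "j \<noteq> 0 \<Longrightarrow> shrink_apex_vector f (Apex j) = max (2 * f (Apex j) - 1) 0"
  by (simp_all add: shrink_apex_vector_def)

lemma support_shrink_apex_vector_subset:
  assumes "\<And>v. 0 \<le> f v"
  shows "support (shrink_apex_vector f) \<subseteq> support f"
proof
  fix v assume "v \<in> support (shrink_apex_vector f)"
  then show "v \<in> support f"
    using assms[of v] by (cases v) (auto simp: support_def shrink_apex_vector_def max_def split: if_splits)
qed

text \<open>If everything vanished, \<open>f\<close> would be concentrated on one apex other than
  \<open>Apex 0\<close>; but its weight there is 1, and 2 - 1 is not 0.\<close>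

lemma support_shrink_apex_vector:
  assumes f: "f \<in> topspace (geometric_realization (cross_complex d k))"
  shows "support (shrink_apex_vector f) \<noteq> {}"
    and "support (shrink_apex_vector f) \<in> cross_complex d k"
proof -
  note F = in_geometric_realizationD[OF complex_on_cross_complex f]
  show ne: "support (shrink_apex_vector f) \<noteq> {}"
  proof
    assume "support (shrink_apex_vector f) = {}"
    then have z: "\<And>v. shrink_apex_vector f v = 0" by (auto simp: support_def)
    obtain v where v: "f v \<noteq> 0" using F(4) by (auto simp: support_def)
    obtain j where j: "v = Apex j" "j \<noteq> 0"
      using z[of v] v by (cases v) (auto simp: shrink_apex_vector_def split: if_splits)
    have "w = Apex j" if w: "f w \<noteq> 0" for w
    proof -
      obtain i where i: "w = Apex i"
        using z[of w] w by (cases w) (auto simp: shrink_apex_vector_def)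
      then have "i = j" using cross_realizationD(2)[OF f, of i j] w v j(1) by blast
      with i show ?thesis by simp
    qed
    then have "f (Apex j) = 1"
      by (intro realization_single_support[OF complex_on_cross_complex f]) (auto simp: support_def)
    then show False using z[of "Apex j"] j by simp
  qed
  show "support (shrink_apex_vector f) \<in> cross_complex d k"
    using complex_onD(3)[OF complex_on_cross_complex F(2) support_shrink_apex_vector_subset[of f]] F(1) ne
    by blast
qed

lemma insert_Apex_in_cross_complex:
  assumes "\<sigma> \<in> cross_complex d k" "j \<le> k" "\<And>i. Apex i \<in> \<sigma> \<Longrightarrow> i = j"
  shows "insert (Apex j) \<sigma> \<in> cross_complex d k"
  using assms by (auto simp: cross_complex_def)

text \<open>With \<open>s\<close> the weight of an apex other than \<open>Apex 0\<close>: where \<open>s \<ge> 1/2\<close> the composite stays in the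
  support of its argument, elsewhere it only adds \<open>Apex 0\<close>; \<open>shrink_apex_vector\<close> discards the
  other apex in the latter case.\<close>

lemma support_from_to_wedge:
  assumes f: "f \<in> topspace (geometric_realization (cross_complex d k))"
  shows "support (from_wedge d k (to_wedge d k f)) \<union> support (shrink_apex_vector f) \<in> cross_complex d k"
proof (cases "\<forall>i\<in>{1..k}. f (Apex i) = 0")
  case True
  then have "to_wedge d k f = None" by (simp add: to_wedge_def)
  moreover have "i = 0" if "Apex i \<in> support (shrink_apex_vector f)" for i
  proof (rule ccontr)
    assume "i \<noteq> 0"
    then have "f (Apex i) \<noteq> 0" using that by (auto simp: support_def)
    then show False using True cross_realizationD(3)[OF f, of "Apex i"] \<open>i \<noteq> 0\<close> by auto
  qed
  ultimately show ?thesis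
    using insert_Apex_in_cross_complex[OF support_shrink_apex_vector(2)[OF f]]
    by (simp add: support_from_wedge_None)
next
  case False
  then obtain j where j: "j \<in> {1..k}" "f (Apex j) \<noteq> 0" by blast
  note F = in_geometric_realizationD[OF complex_on_cross_complex f]
  have j0: "j - 1 < k" "Suc (j - 1) = j" "j \<noteq> 0" using j(1) by auto
  have other: "f (Apex i) = 0" if "i \<noteq> j" for i
    using cross_realizationD(2)[OF f, of i j] that j(2) by blast
  have sub: "support (shrink_apex_vector f) \<subseteq> support f"
    using support_shrink_apex_vector_subset[of f] F(1) by blast
  define c where "c = cone_collapse d j f"
  have c: "c \<in> topspace (nsphere d)"
    unfolding c_def cone_collapse_def by (rule unit_vector_in_nsphere[OF cone_vector_nonzero[OF f]])
  have supp: "support (from_wedge d k (to_wedge d k f)) = support (suspension_vector d (j - 1) c)"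
    using to_wedge_cone[of j k f d] j(1) other suspension_in_realization(2)[OF c j0(1)]
    by (simp add: from_wedge_inj c_def)
  define r where "r = sqrt (\<Sum>i\<le>d. (cone_vector j f i)\<^sup>2)"
  have r: "0 < r"
    unfolding r_def using sum_squares_pos[OF cone_vector_nonzero[OF f]] by simp
  have c0: "c 0 = (1 - 2 * f (Apex j)) / r"
    by (simp add: c_def cone_collapse_def unit_vector_def r_def cone_vector_def)
  have cm: "c m = f (Apex j) * (f (Pos m) - f (Neg m)) / r" if "m \<in> {1..d}" for m
    using that by (simp add: c_def cone_collapse_def unit_vector_def r_def cone_vector_def)
  have sj: "0 < f (Apex j)" using F(1)[of "Apex j"] j(2) by simp
  \<comment> \<open>As the weight of \<open>Apex j\<close> and the norm \<open>r\<close> are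
    positive, \<open>c m\<close> has the sign of the difference of the weights at
    \<open>Pos m\<close> and \<open>Neg m\<close>; so the composite uses only those of these
    vertices that \<open>f\<close> uses.\<close>
  have P: "f (Pos m) \<noteq> 0" if "suspension_vector d (j - 1) c (Pos m) \<noteq> 0" for m
  proof
    assume "f (Pos m) = 0"
    then have "m \<in> {1..d} \<Longrightarrow> c m \<le> 0"
      using cm[of m] F(1)[of "Neg m"] sj r by (simp add: divide_nonpos_pos mult_nonneg_nonpos)
    then show False using that by (simp add: suspension_vector_def split: if_splits)
  qed
  have N: "f (Neg m) \<noteq> 0" if "suspension_vector d (j - 1) c (Neg m) \<noteq> 0" for m
  proof
    assume "f (Neg m) = 0"
    then have "m \<in> {1..d} \<Longrightarrow> 0 \<le> c m"
      using cm[of m] F(1)[of "Pos m"] sj r by simp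
    then show False using that by (simp add: suspension_vector_def split: if_splits)
  qed
  let ?U = "support (from_wedge d k (to_wedge d k f)) \<union> support (shrink_apex_vector f)"
  have ne: "?U \<noteq> {}" using support_shrink_apex_vector(1)[OF f] by blast
  show ?thesis
  proof (cases "f (Apex j) \<ge> 1 / 2")
    case True
    then have "c 0 \<le> 0" using c0 r by (simp add: divide_nonpos_pos)
    then have "support (suspension_vector d (j - 1) c) \<subseteq> support f"
      using P N j(2) j0
      by (intro subsetI, rename_tac v, case_tac v)
        (auto simp: support_def suspension_vector_def[of _ _ _ "Apex _"] split: if_splits)
    then have "?U \<subseteq> support f"
      using supp sub by blast
    then show ?thesis by (rule complex_onD(3)[OF complex_on_cross_complex F(2) _ ne])
  next
    case False
    \<comment> \<open>\<open>Apex j\<close> is the only apex in the support, so once it is removed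
      \<open>Apex 0\<close> can be added.\<close>
    let ?B = "support f - {Apex j}"
    have "0 < c 0" using c0 r False by simp
    then have "support (suspension_vector d (j - 1) c) \<subseteq> insert (Apex 0) ?B"
      using P N j0
      by (intro subsetI, rename_tac v, case_tac v)
        (auto simp: support_def suspension_vector_def[of _ _ _ "Apex _"] split: if_splits)
    moreover have "support (shrink_apex_vector f) \<subseteq> ?B"
      using sub False j0 by (auto simp: support_def)
    ultimately have U: "?U \<subseteq> insert (Apex 0) ?B" using supp by blast
    have "?B \<noteq> {}"
      using support_shrink_apex_vector(1)[OF f] \<open>support (shrink_apex_vector f) \<subseteq> ?B\<close> by blast
    then have "?B \<in> cross_complex d k"
      by (rule complex_onD(3)[OF complex_on_cross_complex F(2) Diff_subset])
    then have "insert (Apex 0) ?B \<in> cross_complex d k"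
      using other by (intro insert_Apex_in_cross_complex) (auto simp: support_def)
    then show ?thesis by (rule complex_onD(3)[OF complex_on_cross_complex _ U ne])
  qed
qed

lemma homotopic_from_to_wedge:
  "homotopic_with (\<lambda>_. True) (geometric_realization (cross_complex d k))
     (geometric_realization (cross_complex d k)) (from_wedge d k \<circ> to_wedge d k) id"
proof -
  let ?X = "geometric_realization (cross_complex d k)"
  let ?h = "\<lambda>f. normalize_weights (cross_verts d k) (shrink_apex_vector f)"
  have nn: "0 \<le> shrink_apex_vector f v" if "f \<in> topspace ?X" for f v
    using in_geometric_realizationD(1)[OF complex_on_cross_complex that]
    by (auto simp: shrink_apex_vector_def split: cross_vertex.split)
  have h: "continuous_map ?X ?X ?h"
  proof (rule continuous_map_normalize_weights[OF complex_on_cross_complex])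
    show "continuous_map ?X euclideanreal (\<lambda>f. shrink_apex_vector f v)" for v
      unfolding shrink_apex_vector_def by (cases v) (auto intro!: continuous_intros)
  qed (use nn support_shrink_apex_vector in auto)
  have sh: "support (?h f) = support (shrink_apex_vector f)" if "f \<in> topspace ?X" for f
    using normalize_weights_in_realization(2)[OF complex_on_cross_complex nn[OF that]
        support_shrink_apex_vector(2)[OF that] support_shrink_apex_vector(1)[OF that]] .
  have "homotopic_with (\<lambda>_. True) ?X ?X (from_wedge d k \<circ> to_wedge d k) ?h"
  proof (rule homotopic_with_common_carrier[OF complex_on_cross_complex _ h])
    show "continuous_map ?X ?X (from_wedge d k \<circ> to_wedge d k)"
      using continuous_map_compose[OF continuous_map_to_wedge continuous_map_from_sphere_wedge] .
  qed (use support_from_to_wedge sh in simp)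
  moreover have "homotopic_with (\<lambda>_. True) ?X ?X ?h id"
  proof (rule homotopic_with_common_carrier[OF complex_on_cross_complex h])
    fix f assume f: "f \<in> topspace ?X"
    note F = in_geometric_realizationD[OF complex_on_cross_complex f]
    have "support (?h f) \<union> support (id f) = support f"
      using sh[OF f] support_shrink_apex_vector_subset[of f] F(1) by auto
    then show "support (?h f) \<union> support (id f) \<in> cross_complex d k" using F(2) by simp
  qed simp
  ultimately show ?thesis by (rule homotopic_with_trans)
qed

text \<open>The composite maps each copy to itself, so within each sphere the segment from
  \<open>x\<close> to its image is projected radially. The segment avoids the origin: apart from
  coordinate 0, no coordinate of the image has the opposite sign to that of \<open>x\<close>, so
  cancellation could occur only at the two poles, and these are fixed. The base point does not move,
  hence the homotopies fit together. For \<open>k = 0\<close> there are no copies and the wedge is a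
  point.\<close>

lemma homotopic_to_from_wedge:
  "homotopic_with (\<lambda>_. True) (sphere_wedge k d) (sphere_wedge k d) (to_wedge d k \<circ> from_wedge d k) id"
proof (cases "k = 0")
  case True
  have "continuous_map (sphere_wedge k d) (sphere_wedge k d) (to_wedge d k \<circ> from_wedge d k)"
    using continuous_map_compose[OF continuous_map_from_sphere_wedge continuous_map_to_wedge] .
  then show ?thesis
    by (rule homotopic_with_equal[rotated 2])
      (use True in \<open>auto simp: sphere_wedge_def topspace_wedge_copies to_wedge_def\<close>)
next
  case False
  let ?I = "top_of_set {0..1::real}" and ?S = "nsphere d"
  \<comment> \<open>The composite seen inside copy \<open>i\<close>, whose apex is
    \<open>Apex (Suc i)\<close>.\<close>
  define \<phi> where "\<phi> i x = cone_collapse d (Suc i) (normalize_weights (cross_verts d k) (suspension_vector d i x))"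
    for i x
  define v where "v i \<tau> x = (\<lambda>m. (1 - \<tau>) * x m + \<tau> * \<phi> i x m)" for i and \<tau> :: real and x
  define h where "h = (\<lambda>(\<tau>, w). case w of None \<Rightarrow> None
      | Some (i, x) \<Rightarrow> wedge_inj sphere_base i (unit_vector d (v i \<tau> x)))"
  have cont_\<phi>: "continuous_map ?S ?S (\<phi> i)" if "i < k" for i
    using continuous_map_compose[OF continuous_map_suspension[OF that] continuous_map_cone_collapse]
    unfolding \<phi>_def by (simp add: o_def)
  have \<phi>_sphere: "\<phi> i x \<in> topspace ?S" if "i < k" "x \<in> topspace ?S" for i x
    using cont_\<phi>[OF that(1)] that(2) continuous_map_image_subset_topspace by blast
  have \<phi>_base: "\<phi> i sphere_base = sphere_base" for i
    unfolding \<phi>_def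
    by (rule cone_collapse_base) (simp add: normalize_weights_def suspension_vector_def sphere_base_def)
  have to_from: "to_wedge d k (from_wedge d k (wedge_inj sphere_base i x)) = wedge_inj sphere_base i (\<phi> i x)"
    if "i < k" for i x
  proof -
    have "to_wedge d k (normalize_weights (cross_verts d k) (suspension_vector d i x))
        = wedge_inj sphere_base (Suc i - 1) (\<phi> i x)"
      unfolding \<phi>_def using that
      by (intro to_wedge_cone) (auto simp: normalize_weights_def suspension_vector_def)
    then show ?thesis by (simp add: from_wedge_inj)
  qed
  have nonzero: "\<exists>m\<le>d. v i \<tau> x m \<noteq> 0" if i: "i < k" and x: "x \<in> topspace ?S" and \<tau>: "0 \<le> \<tau>" "\<tau> \<le> 1"
    for i \<tau> x
  proof (rule ccontr)
    assume "\<not> ?thesis"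
    then have z: "\<And>m. m \<le> d \<Longrightarrow> (1 - \<tau>) * x m + \<tau> * \<phi> i x m = 0" by (auto simp: v_def)
    let ?f = "normalize_weights (cross_verts d k) (suspension_vector d i x)"
    have f: "?f \<in> topspace (geometric_realization (cross_complex d k))"
      by (rule suspension_in_realization(1)[OF x i])
    have "\<tau> \<noteq> 1"
      using z nsphere_nonzero[OF \<phi>_sphere[OF i x]] by auto
    \<comment> \<open>For m at least 1 the coordinate \<open>\<phi> i x m\<close> is a nonnegative
      multiple \<mu> of \<open>x m\<close>, so on the segment \<open>x m\<close> is multiplied by
      the positive factor \<open>(1 - \<tau>) + \<tau> * \<mu>\<close>.\<close>
    have xm: "x m = 0" if m: "m \<in> {1..d}" for m
    proof -
      define T where "T = sum (suspension_vector d i x) (cross_verts d k)"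
      define r where "r = sqrt (\<Sum>m\<le>d. (cone_vector (Suc i) ?f m)\<^sup>2)"
      have T: "0 \<le> T" unfolding T_def by (intro sum_nonneg suspension_vector_nonneg)
      have "0 \<le> r" unfolding r_def by (simp add: sum_nonneg)
      have "?f (Pos m) - ?f (Neg m) = x m / T"
        using m by (simp add: normalize_weights_def T_def suspension_vector_def max_def)
      then have "\<phi> i x m = ?f (Apex (Suc i)) / T / r * x m"
        using m by (simp add: \<phi>_def cone_collapse_def unit_vector_def cone_vector_def r_def)
      moreover have "0 \<le> ?f (Apex (Suc i)) / T / r"
        using in_geometric_realizationD(1)[OF complex_on_cross_complex f] T \<open>0 \<le> r\<close> by simp
      ultimately obtain \<mu> where \<mu>: "0 \<le> \<mu>" "\<phi> i x m = \<mu> * x m" by blast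
      have "((1 - \<tau>) + \<tau> * \<mu>) * x m = 0" using z[of m] m \<mu>(2) by (simp add: algebra_simps)
      moreover have "(1 - \<tau>) + \<tau> * \<mu> > 0" using \<open>\<tau> \<noteq> 1\<close> \<tau> \<mu>(1) by (simp add: add_pos_nonneg)
      ultimately show "x m = 0" by simp
    qed
    have "x 0 \<noteq> 0"
      using nsphere_nonzero[OF x] xm by (metis One_nat_def Suc_leI atLeastAtMost_iff neq0_conv)
    have "(\<Sum>m\<le>d. (x m)\<^sup>2) = (x 0)\<^sup>2"
      using xm by (subst sum.remove[of _ 0]) (auto intro!: sum.neutral)
    then have x0: "x 0 = 1 \<or> x 0 = -1" using x by (simp add: nsphere power2_eq_1_iff)
    have "x m = 0" if "m \<noteq> 0" for m
      using xm[of m] x that by (cases "m \<le> d") (auto simp: nsphere)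
    then have xpole: "x = sphere_base \<or> x = (\<lambda>m. - sphere_base m)"
      using x0 by (auto simp: sphere_base_def fun_eq_iff)
    \<comment> \<open>Both poles are fixed: one is the base point, the other corresponds to the apex
      itself, where the cone formula gives -1 in coordinate 0 and 0 elsewhere.\<close>
    have "\<phi> i x 0 = x 0"
      using xpole
    proof
      assume "x = sphere_base" then show ?thesis by (simp add: \<phi>_base)
    next
      assume xn: "x = (\<lambda>m. - sphere_base m)"
      have "support (suspension_vector d i x) \<subseteq> {Apex (Suc i)}"
        using xn by (intro subsetI, rename_tac v, case_tac v)
          (auto simp: support_def suspension_vector_def sphere_base_def split: if_splits)
      then have s1: "?f (Apex (Suc i)) = 1"
        using suspension_in_realization(2)[OF x i]
        by (intro realization_single_support[OF complex_on_cross_complex f]) simp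
      have "?f (Pos m) = 0" "?f (Neg m) = 0" if "m \<noteq> 0" for m
        using xn that by (auto simp: normalize_weights_def suspension_vector_def sphere_base_def)
      then have "cone_vector (Suc i) ?f = x"
        using s1 fun_cong[OF xn] by (auto simp: cone_vector_def sphere_base_def fun_eq_iff)
      then show ?thesis
        unfolding \<phi>_def cone_collapse_def by (simp add: unit_vector_of_nsphere[OF x])
    qed
    then have "x 0 = 0" using z[of 0] by (simp add: algebra_simps)
    with \<open>x 0 \<noteq> 0\<close> show False by simp
  qed
  have v_base: "unit_vector d (v i \<tau> sphere_base) = sphere_base" for i \<tau>
  proof -
    have "v i \<tau> sphere_base = sphere_base" by (auto simp: v_def \<phi>_base algebra_simps)
    then show ?thesis using unit_vector_of_nsphere[OF sphere_base_in_nsphere] by simp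
  qed
  have h_inj: "h (\<tau>, wedge_inj sphere_base i x) = wedge_inj sphere_base i (unit_vector d (v i \<tau> x))"
    for i \<tau> x
    by (auto simp: h_def wedge_inj_def v_base)
  have "continuous_map (prod_topology ?I (sphere_wedge k d)) (sphere_wedge k d) h"
    unfolding sphere_wedge_def
  proof (rule continuous_map_prod_wedge[OF closedin_nsphere_base])
    fix i assume i: "i < k"
    have "continuous_map (prod_topology ?I ?S) ?S (\<lambda>p. unit_vector d (v i (fst p) (snd p)))"
    proof (rule continuous_map_unit_vector)
      fix m
      have 1: "continuous_map (prod_topology ?I ?S) euclideanreal fst"
        using continuous_map_into_fulltopology[OF continuous_map_fst] .
      have 2: "continuous_map (prod_topology ?I ?S) euclideanreal (\<lambda>p. snd p m)"
        using continuous_map_compose[OF continuous_map_snd continuous_map_nsphere_projection]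
        by (simp add: o_def)
      have 3: "continuous_map (prod_topology ?I ?S) euclideanreal (\<lambda>p. \<phi> i (snd p) m)"
        using continuous_map_compose[OF continuous_map_snd
            continuous_map_compose[OF cont_\<phi>[OF i] continuous_map_nsphere_projection]]
        by (simp add: o_def)
      show "continuous_map (prod_topology ?I ?S) euclideanreal (\<lambda>p. v i (fst p) (snd p) m)"
        unfolding v_def by (intro continuous_intros 1 2 3)
    qed (use nonzero[OF i] in auto)
    from continuous_map_compose[OF this continuous_map_wedge_inj[OF i]]
    show "continuous_map (prod_topology ?I ?S) (wedge_copies k ?S sphere_base)
            (\<lambda>(z, x). h (z, wedge_inj sphere_base i x))"
      by (simp add: h_inj o_def case_prod_unfold)
  qed (use False in simp)
  moreover have "h (0, w) = w \<and> h (1, w) = to_wedge d k (from_wedge d k w)"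
    if w: "w \<in> topspace (sphere_wedge k d)" for w
  proof -
    obtain i x where ix: "i < k" "x \<in> topspace ?S" "w = wedge_inj sphere_base i x"
      using wedge_copies_cases[OF w[unfolded sphere_wedge_def] sphere_base_in_nsphere] False by blast
    have "v i 0 x = x" "v i 1 x = \<phi> i x" by (auto simp: v_def)
    then show ?thesis
      using ix unit_vector_of_nsphere \<phi>_sphere to_from by (simp add: h_inj)
  qed
  ultimately have "homotopic_with (\<lambda>_. True) (sphere_wedge k d) (sphere_wedge k d)
      id (to_wedge d k \<circ> from_wedge d k)"
    by (subst homotopic_with) (auto intro!: exI[of _ h])
  then show ?thesis by (rule homotopic_with_symD)
qed

lemma cross_complex_homotopy_equivalent_sphere_wedge:
  "geometric_realization (cross_complex d k) homotopy_equivalent_space sphere_wedge k d"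
  unfolding homotopy_equivalent_space_def
  by (intro exI[of _ "to_wedge d k"] exI[of _ "from_wedge d k"] conjI continuous_map_to_wedge
      continuous_map_from_sphere_wedge homotopic_from_to_wedge homotopic_to_from_wedge)

section \<open>Independence complexes of a matching together with a clique\<close>

fun cross_adj :: "cross_vertex \<Rightarrow> cross_vertex \<Rightarrow> bool" where
  "cross_adj (Pos i) (Neg j) \<longleftrightarrow> i = j"
| "cross_adj (Neg i) (Pos j) \<longleftrightarrow> i = j"
| "cross_adj (Apex i) (Apex j) \<longleftrightarrow> i \<noteq> j"
| "cross_adj _ _ \<longleftrightarrow> False"

lemma cross_complex_eq_ind_complex: "cross_complex d k = ind_complex (cross_verts d k) cross_adj"
proof -
  have "(\<forall>x\<in>\<sigma>. \<forall>y\<in>\<sigma>. \<not> cross_adj x y) \<longleftrightarrow>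
      (\<forall>i. \<not> (Pos i \<in> \<sigma> \<and> Neg i \<in> \<sigma>)) \<and> (\<forall>i j. Apex i \<in> \<sigma> \<and> Apex j \<in> \<sigma> \<longrightarrow> i = j)" (is "?L \<longleftrightarrow> ?R") for \<sigma>
  proof
    assume L: ?L
    then have "\<not> cross_adj (Pos i) (Neg i)" if "Pos i \<in> \<sigma>" "Neg i \<in> \<sigma>" for i using that by blast
    moreover have "\<not> cross_adj (Apex i) (Apex j)" if "Apex i \<in> \<sigma>" "Apex j \<in> \<sigma>" for i j
      using that L by blast
    ultimately show ?R by auto
  next
    assume R: ?R
    have "\<not> cross_adj x y" if "x \<in> \<sigma>" "y \<in> \<sigma>" for x y
      using R that by (cases x; cases y) auto
    then show ?L by blast
  qed
  then show ?thesis unfolding cross_complex_def ind_complex_def by simp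
qed

text \<open>An independent set takes at most one end of each matching edge and at most one clique
  vertex, just as a simplex of \<open>cross_complex\<close> does with antipodal pairs and apexes.
  The two complexes differ only in the names of their vertices.\<close>

lemma ind_complex_matching_clique:
  assumes fin: "finite I" "finite J" and card: "card I = d" "card J = Suc k"
    and p: "inj_on p I" and disj: "I \<inter> p ` I = {}" "I \<inter> J = {}" "p ` I \<inter> J = {}"
    and sym: "\<And>x y. E x y \<Longrightarrow> E y x"
    and matching: "\<And>x y. x \<in> I \<union> p ` I \<Longrightarrow> y \<in> I \<union> p ` I \<Longrightarrow>
      E x y \<longleftrightarrow> x \<in> I \<and> y = p x \<or> y \<in> I \<and> x = p y"
    and clique: "\<And>x y. x \<in> J \<Longrightarrow> y \<in> J \<Longrightarrow> E x y \<longleftrightarrow> x \<noteq> y"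
    and separate: "\<And>x y. x \<in> I \<union> p ` I \<Longrightarrow> y \<in> J \<Longrightarrow> \<not> E x y"
  shows "geometric_realization (ind_complex (I \<union> p ` I \<union> J) E) homotopy_equivalent_space sphere_wedge k d"
proof -
  obtain a where a: "bij_betw a I {1..d}"
    using fin card by (metis card_atLeastAtMost diff_Suc_1 finite_atLeastAtMost finite_same_card_bij)
  obtain b where b: "bij_betw b J {..k}"
    using fin card by (metis card_atMost finite_atMost finite_same_card_bij)
  define r where "r x = (if x \<in> I then Pos (a x) else if x \<in> J then Apex (b x)
    else Neg (a (inv_into I p x)))" for x
  have rI: "r x = Pos (a x)" if "x \<in> I" for x using that by (simp add: r_def)
  have rJ: "r x = Apex (b x)" if "x \<in> J" for x using that disj by (auto simp: r_def)
  have rp: "r (p x) = Neg (a x)" if "x \<in> I" for x using that disj p by (auto simp: r_def)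
  have aI: "a x = a y \<longleftrightarrow> x = y" if "x \<in> I" "y \<in> I" for x y
    using a that by (auto simp: bij_betw_def inj_on_def)
  have bJ: "b x = b y \<longleftrightarrow> x = y" if "x \<in> J" "y \<in> J" for x y
    using b that by (auto simp: bij_betw_def inj_on_def)
  have pI: "p x = p y \<longleftrightarrow> x = y" if "x \<in> I" "y \<in> I" for x y
    using p that by (auto simp: inj_on_def)
  have sep2: "x \<noteq> p y" if "x \<in> I" "y \<in> I" for x y
    using disj that by auto
  have img: "r ` (I \<union> p ` I \<union> J) = cross_verts d k"
  proof -
    have "r ` I = Pos ` a ` I" "r ` p ` I = Neg ` a ` I" "r ` J = Apex ` b ` J"
      using rI rp rJ by (force simp: image_image)+
    then show ?thesis using a b by (simp add: image_Un cross_verts_def bij_betw_def)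
  qed
  have inj: "inj_on r (I \<union> p ` I \<union> J)"
    by (rule inj_onI) (auto simp: rI rp rJ aI bJ)
  have "bij_betw r (I \<union> p ` I \<union> J) (cross_verts d k)" using img inj by (simp add: bij_betw_def)
  moreover have "cross_adj (r x) (r y) \<longleftrightarrow> E x y"
    if xy: "x \<in> I \<union> p ` I \<union> J" "y \<in> I \<union> p ` I \<union> J" for x y
  proof -
    consider (matching) "x \<in> I \<union> p ` I" "y \<in> I \<union> p ` I" | (clique) "x \<in> J" "y \<in> J"
      | (separate) "x \<in> I \<union> p ` I" "y \<in> J" | (separate') "x \<in> J" "y \<in> I \<union> p ` I"
      using xy by blast
    then show ?thesis
    proof cases
      case matching
      then show ?thesis
        unfolding assms(10)[OF matching] using sep2 by (auto simp: rI rp aI pI)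
    next
      case clique
      then show ?thesis unfolding assms(11)[OF clique] by (simp add: rJ bJ)
    next
      case separate
      then have "\<not> E x y" by (rule assms(12))
      then show ?thesis using separate by (auto simp: rI rp rJ)
    next
      case separate'
      then have "\<not> E x y" using assms(12) sym by blast
      then show ?thesis using separate' by (auto simp: rI rp rJ)
    qed
  qed
  ultimately have "geometric_realization (ind_complex (I \<union> p ` I \<union> J) E) homotopy_equivalent_space
      geometric_realization (ind_complex (cross_verts d k) cross_adj)"
    using fin by (intro ind_complex_isomorphic) auto
  then show ?thesis
    using homotopy_eqv_trans cross_complex_homotopy_equivalent_sphere_wedge[of d k]
    unfolding cross_complex_eq_ind_complex by blast
qed

section \<open>Morse complexes of rooted trees\<close>

text \<open>At a highest vertex of a closed path both neighbours along the path are lower, hence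
  both are its parent. The step into this vertex and the step out of it then use the same edge,
  which would be paired with two different vertices.\<close>

lemma discrete_vector_field_acyclic:
  fixes h :: "'a \<Rightarrow> nat"
  assumes dvf: "discrete_vector_field G V"
    and height: "\<And>v w. {v, w} \<in> edges G \<Longrightarrow> v \<noteq> w \<Longrightarrow> h v \<noteq> h w"
    and parent: "\<And>v a b. {v, a} \<in> edges G \<Longrightarrow> {v, b} \<in> edges G \<Longrightarrow> h a < h v \<Longrightarrow> h b < h v \<Longrightarrow> a = b"
    and path: "V_path V vs es" "es \<noteq> []"
  shows "last vs \<noteq> hd vs"
proof
  assume closed: "last vs = hd vs"
  define k where "k = length es"
  have k: "0 < k" "length vs = Suc k" using path by (auto simp: k_def V_path_def)
  have step: "(vs ! i, es ! i) \<in> V" "vs ! Suc i \<noteq> vs ! i" "es ! i = {vs ! i, vs ! Suc i}"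
    if "i < k" for i using path(1) that by (auto simp: V_path_def k_def)
  have edge: "{vs ! i, vs ! Suc i} \<in> edges G" if "i < k" for i
    using step[OF that] dvf by (auto simp: discrete_vector_field_def)
  have "vs \<noteq> []" using k by auto
  then have wrap: "vs ! k = vs ! 0" using closed k by (simp add: last_conv_nth hd_conv_nth)
  \<comment> \<open>Index 0 is left out so that the chosen position has a predecessor; nothing is
    lost because the path is closed.\<close>
  define M where "M = Max ((\<lambda>i. h (vs ! i)) ` {1..k})"
  have "M \<in> (\<lambda>i. h (vs ! i)) ` {1..k}" unfolding M_def using k by (intro Max_in) auto
  then obtain m where m: "m \<in> {1..k}" "h (vs ! m) = M" by auto
  have max: "h (vs ! i) \<le> h (vs ! m)" if "i \<le> k" for i
  proof -
    have "\<exists>j\<in>{1..k}. vs ! i = vs ! j" 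
      using that k wrap by (intro bexI[of _ "if i = 0 then k else i"]) auto
    then show ?thesis unfolding m(2) M_def by auto
  qed
  \<comment> \<open>The position from which the path leaves the highest vertex: at the end of the
    list it continues from the start.\<close>
  define m' where "m' = (if m = k then 0 else m)"
  have m': "m' < k" "vs ! m' = vs ! m" using m(1) k wrap by (auto simp: m'_def)
  have pm: "m - 1 < k" "Suc (m - 1) = m" using m(1) by auto
  have e1: "{vs ! m, vs ! (m - 1)} \<in> edges G" and ne1: "vs ! m \<noteq> vs ! (m - 1)"
    using edge[OF pm(1)] step(2)[OF pm(1)] pm(2) by (auto simp: insert_commute)
  have e2: "{vs ! m, vs ! Suc m'} \<in> edges G" and ne2: "vs ! m \<noteq> vs ! Suc m'"
    using edge[OF m'(1)] step(2)[OF m'(1)] m'(2) by auto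
  have "h (vs ! (m - 1)) < h (vs ! m)"
    using max[of "m - 1"] height[OF e1 ne1] pm by simp
  moreover have "h (vs ! Suc m') < h (vs ! m)"
    using max[of "Suc m'"] height[OF e2 ne2] m'(1) by simp
  ultimately have "vs ! (m - 1) = vs ! Suc m'" using parent[OF e1 e2] by blast
  then have "es ! (m - 1) = es ! m'"
    using step(3)[OF pm(1)] step(3)[OF m'(1)] m'(2) pm(2) by auto
  moreover have "(vs ! (m - 1), es ! (m - 1)) \<in> V" "(vs ! m', es ! m') \<in> V"
    using step(1) pm(1) m'(1) by auto
  ultimately have "(vs ! (m - 1), es ! (m - 1)) = (vs ! m', es ! m')"
    using dvf unfolding discrete_vector_field_def by (metis snd_conv)
  then show False using ne1 m'(2) by simp
qed

text \<open>In a rooted tree every edge joins a vertex \<open>c\<close> other than the root to its parent \<open>par c\<close>. The pair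
  \<open>(c, False)\<close> stands for the primitive vector field at \<open>c\<close> on this edge and \<open>(c, True)\<close> for the
  one at \<open>par c\<close>.\<close>

definition tree_conflict :: "('a \<Rightarrow> 'a) \<Rightarrow> 'a \<times> bool \<Rightarrow> 'a \<times> bool \<Rightarrow> bool" where
  "tree_conflict par x y \<longleftrightarrow> x \<noteq> y \<and>
     (fst x = fst y \<or> (if snd x then par (fst x) else fst x) = (if snd y then par (fst y) else fst y))"

lemma tree_conflict_sym: "tree_conflict par x y \<Longrightarrow> tree_conflict par y x"
  unfolding tree_conflict_def by metis

text \<open>\<open>q\<close> turns a label into the pair of vertex and edge that it stands for. The
  height \<open>h\<close>, smaller at parents, expresses that \<open>G\<close> is a tree: it makes
  the child of an edge unique, so that \<open>q\<close> is injective, and it rules out closed paths.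
  Vertices of the Morse complex are one-element fields, whence the singletons \<open>{q x}\<close>
  in the isomorphism.\<close>

lemma morse_complex_rooted_tree:
  fixes h :: "'a \<Rightarrow> nat"
  assumes fin: "finite C" and verts: "verts G = insert z C"
    and edges: "edges G = (\<lambda>c. {par c, c}) ` C"
    and par: "\<And>c. c \<in> C \<Longrightarrow> par c \<in> insert z C" and h: "\<And>c. c \<in> C \<Longrightarrow> h (par c) < h c"
  shows "geometric_realization (ind_complex (C \<times> UNIV) (tree_conflict par)) homotopy_equivalent_space
         geometric_realization (morse_complex G)"
proof -
  define q where "q x = (if snd x then par (fst x) else fst x, {par (fst x), fst x})" for x :: "'a \<times> bool"
  have edge: "{v, w} \<in> edges G \<longleftrightarrow> v \<in> C \<and> w = par v \<or> w \<in> C \<and> v = par w" for v w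
    unfolding edges by (auto simp: doubleton_eq_iff)
  have low: "a = par v" if "{v, a} \<in> edges G" "h a < h v" for v a
    using that h[of a] unfolding edge by (auto dest: less_asym)
  have grad: "gradient_vector_field G V \<longleftrightarrow> discrete_vector_field G V" for V
  proof -
    have "last vs \<noteq> hd vs" if "discrete_vector_field G V" "V_path V vs es" "es \<noteq> []" for vs es
    proof (rule discrete_vector_field_acyclic[OF that(1) _ _ that(2,3), of h])
      fix v w assume "{v, w} \<in> edges G" "v \<noteq> w"
      then show "h v \<noteq> h w" using h unfolding edge by fastforce
    next
      fix v a b assume "{v, a} \<in> edges G" "{v, b} \<in> edges G" "h a < h v" "h b < h v"
      then show "a = b" using low by metis
    qed
    then show ?thesis unfolding gradient_vector_field_def by blast
  qed
  have child: "c = c'" if "c \<in> C" "c' \<in> C" "{par c, c} = {par c', c'}" for c c'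
    using that h[of c] h[of c'] by (auto simp: doubleton_eq_iff)
  have q_inj: "x = y" if "q x = q y" "x \<in> C \<times> UNIV" "y \<in> C \<times> UNIV" for x y
  proof -
    have 1: "fst x = fst y" using child[of "fst x" "fst y"] that by (auto simp: q_def)
    moreover have "par (fst x) \<noteq> fst x" using h[of "fst x"] that by auto
    ultimately have "snd x = snd y" using that(1) by (auto simp: q_def split: if_splits)
    with 1 show ?thesis by (simp add: prod_eq_iff)
  qed
  have q_range: "v \<in> verts G \<and> e \<in> edges G \<and> v \<in> e \<longleftrightarrow> (v, e) \<in> q ` (C \<times> UNIV)" for v e
  proof
    assume L: "v \<in> verts G \<and> e \<in> edges G \<and> v \<in> e"
    then obtain c where c: "c \<in> C" "e = {par c, c}" by (auto simp: edges)
    then have "(v, e) = q (c, v \<noteq> c)" using L by (auto simp: q_def)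
    then show "(v, e) \<in> q ` (C \<times> UNIV)" using c by blast
  next
    assume "(v, e) \<in> q ` (C \<times> UNIV)"
    then obtain c b where "c \<in> C" "(v, e) = q (c, b)" by auto
    then show "v \<in> verts G \<and> e \<in> edges G \<and> v \<in> e"
      using par[of c] by (auto simp: q_def verts edges)
  qed
  have conflict: "tree_conflict par x y \<longleftrightarrow> q x \<noteq> q y \<and> (fst (q x) = fst (q y) \<or> snd (q x) = snd (q y))"
    if "x \<in> C \<times> UNIV" "y \<in> C \<times> UNIV" for x y
  proof -
    have "snd (q x) = snd (q y) \<longleftrightarrow> fst x = fst y"
      using child[of "fst x" "fst y"] that by (auto simp: q_def)
    moreover have "q x \<noteq> q y \<longleftrightarrow> x \<noteq> y" using q_inj that by blast
    moreover have "fst (q w) = (if snd w then par (fst w) else fst w)" for w by (simp add: q_def)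
    ultimately show ?thesis unfolding tree_conflict_def by (simp only:) blast
  qed
  have dvf: "discrete_vector_field G (q ` \<sigma>) \<longleftrightarrow> (\<forall>x\<in>\<sigma>. \<forall>y\<in>\<sigma>. \<not> tree_conflict par x y)"
    if "\<sigma> \<subseteq> C \<times> UNIV" for \<sigma>
  proof -
    have "\<forall>(v, e)\<in>q ` \<sigma>. v \<in> verts G \<and> e \<in> edges G \<and> v \<in> e"
      using that q_range by blast
    then have "discrete_vector_field G (q ` \<sigma>) \<longleftrightarrow>
        (\<forall>x\<in>\<sigma>. \<forall>y\<in>\<sigma>. fst (q x) = fst (q y) \<or> snd (q x) = snd (q y) \<longrightarrow> q x = q y)"
      unfolding discrete_vector_field_def by simp
    then show ?thesis using that conflict by (meson subsetD)
  qed
  have prim: "primitive_gradient_vector_field G W \<longleftrightarrow> (\<exists>x\<in>C \<times> UNIV. W = {q x})" for W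
  proof -
    have "discrete_vector_field G {(v, e)} \<longleftrightarrow> v \<in> verts G \<and> e \<in> edges G \<and> v \<in> e" for v e
      by (simp add: discrete_vector_field_def)
    then have "primitive_gradient_vector_field G W \<longleftrightarrow>
        (\<exists>v e. W = {(v, e)} \<and> v \<in> verts G \<and> e \<in> edges G \<and> v \<in> e)"
      unfolding primitive_gradient_vector_field_def grad by metis
    also have "\<dots> \<longleftrightarrow> (\<exists>v e. W = {(v, e)} \<and> (v, e) \<in> q ` (C \<times> UNIV))"
      by (simp only: q_range)
    also have "\<dots> \<longleftrightarrow> (\<exists>x\<in>C \<times> UNIV. W = {q x})" by (metis (no_types, lifting) image_iff surj_pair)
    finally show ?thesis .
  qed
  have fin': "finite (C \<times> (UNIV :: bool set))" using fin by simp
  show ?thesis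
  proof (rule homotopy_equivalent_isomorphic[OF complex_on_ind_complex[OF fin'], of "(\<lambda>x. {q x}) ` (C \<times> UNIV)" _ "\<lambda>x. {q x}"])
    have "morse_complex G \<subseteq> Pow ((\<lambda>x. {q x}) ` (C \<times> UNIV))"
      unfolding morse_complex_def prim by blast
    then show "complex_on ((\<lambda>x. {q x}) ` (C \<times> UNIV)) (morse_complex G)"
      using fin' morse_complex_closed unfolding complex_on_def by blast
    show "bij_betw (\<lambda>x. {q x}) (C \<times> UNIV) ((\<lambda>x. {q x}) ` (C \<times> UNIV))"
      using q_inj by (auto intro!: inj_on_imp_bij_betw inj_onI)
    fix \<sigma> :: "('a \<times> bool) set" assume s: "\<sigma> \<subseteq> C \<times> UNIV"
    have "\<Union>((\<lambda>x. {q x}) ` \<sigma>) = q ` \<sigma>" by blast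
    moreover have "\<forall>W\<in>(\<lambda>x. {q x}) ` \<sigma>. primitive_gradient_vector_field G W"
      unfolding prim using s by blast
    moreover have "finite ((\<lambda>x. {q x}) ` \<sigma>)" using s fin' finite_subset by blast
    ultimately have "(\<lambda>x. {q x}) ` \<sigma> \<in> morse_complex G \<longleftrightarrow> \<sigma> \<noteq> {} \<and> discrete_vector_field G (q ` \<sigma>)"
      unfolding morse_complex_def mem_Collect_eq by (simp add: grad)
    then show "\<sigma> \<in> ind_complex (C \<times> UNIV) (tree_conflict par) \<longleftrightarrow> (\<lambda>x. {q x}) ` \<sigma> \<in> morse_complex G"
      using dvf[OF s] s unfolding ind_complex_def by simp
  qed
qed

section \<open>The conflict graph of a path with two extended stars\<close>

text \<open>The root is \<open>Spine 0\<close>. The values at the root and at the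
  \<open>Center\<close> of either star are defaults: the root is no child, and \<open>attach\<close>
  has replaced the centers by spine vertices.\<close>

fun glued_parent :: "nat \<Rightarrow> glued_vertex \<Rightarrow> glued_vertex" where
  "glued_parent t (Spine i) = Spine (i - 1)"
| "glued_parent t (InLeft (Tip j)) = InLeft (Mid j)"
| "glued_parent t (InLeft _) = Spine 0"
| "glued_parent t (InRight (Tip j)) = InRight (Mid j)"
| "glued_parent t (InRight _) = Spine t"

fun glued_height :: "nat \<Rightarrow> glued_vertex \<Rightarrow> nat" where
  "glued_height t (Spine i) = i"
| "glued_height t (InLeft (Tip j)) = 2"
| "glued_height t (InLeft _) = 1"
| "glued_height t (InRight (Tip j)) = t + 2"
| "glued_height t (InRight _) = t + 1"

definition arm_verts :: "nat \<Rightarrow> nat \<Rightarrow> glued_vertex set" where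
  "arm_verts n l = insert (InLeft (Leaf 0)) (InLeft ` (Mid ` {..<n} \<union> Tip ` {..<n}) \<union>
     InRight ` (Mid ` {..<l} \<union> Tip ` {..<l}))"

lemma verts_path_two_stars:
  "verts (path_two_stars t (extended_star 1 n) (extended_star 0 l))
     = insert (Spine 0) (Spine ` {1..t} \<union> arm_verts n l)"
proof -
  have "Spine ` {0..t} = insert (Spine 0) (Spine ` {1..t})" by force
  then show ?thesis
    by (auto simp: path_two_stars_def graph_union_def map_graph_def path_graph_def extended_star_def
        arm_verts_def attach_def)
qed

lemma edges_path_two_stars:
  "edges (path_two_stars t (extended_star 1 n) (extended_star 0 l))
     = (\<lambda>c. {glued_parent t c, c}) ` (Spine ` {1..t} \<union> arm_verts n l)"
proof -
  have "edges (path_graph t) = (\<lambda>i. {i - 1, i}) ` {1..t}"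
    by (auto simp: path_graph_def)
  then have p: "(`) Spine ` edges (path_graph t) = (\<lambda>c. {glued_parent t c, c}) ` Spine ` {1..t}"
    by (simp add: image_image)
  have "edges (extended_star 1 n) = insert {Center, Leaf 0}
      ((\<lambda>j. {Center, Mid j}) ` {..<n} \<union> (\<lambda>j. {Mid j, Tip j}) ` {..<n})"
    by (auto simp: extended_star_def)
  then have l: "(`) (attach InLeft (Spine 0)) ` edges (extended_star 1 n)
      = (\<lambda>c. {glued_parent t c, c}) ` insert (InLeft (Leaf 0)) (InLeft ` (Mid ` {..<n} \<union> Tip ` {..<n}))"
    by (simp add: attach_def image_Un image_image insert_commute)
  have "edges (extended_star 0 l) = (\<lambda>j. {Center, Mid j}) ` {..<l} \<union> (\<lambda>j. {Mid j, Tip j}) ` {..<l}"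
    by (auto simp: extended_star_def)
  then have r: "(`) (attach InRight (Spine t)) ` edges (extended_star 0 l)
      = (\<lambda>c. {glued_parent t c, c}) ` InRight ` (Mid ` {..<l} \<union> Tip ` {..<l})"
    by (simp add: attach_def image_Un image_image insert_commute)
  show ?thesis
    unfolding path_two_stars_def graph_union_def map_graph_def arm_verts_def
    by (simp only: fst_conv snd_conv p l r image_Un[symmetric] Un_insert_left Un_insert_right)
qed

text \<open>The primitive vector fields along the path, in the order in which they meet: each conflicts with
  its predecessor and its successor.\<close>

definition spine_label :: "nat \<Rightarrow> glued_vertex \<times> bool" where
  "spine_label i = (Spine ((i + 1) div 2), odd i)"

abbreviation glued_conflict :: "nat \<Rightarrow> glued_vertex \<times> bool \<Rightarrow> glued_vertex \<times> bool \<Rightarrow> bool" where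
  "glued_conflict t \<equiv> tree_conflict (glued_parent t)"

lemma spine_label_inject [simp]: "spine_label i = spine_label j \<longleftrightarrow> i = j"
proof
  assume "spine_label i = spine_label j"
  then have "(i + 1) div 2 = (j + 1) div 2" "odd i = odd j" by (simp_all add: spine_label_def)
  then show "i = j" by presburger
qed simp

lemma spine_label_neq [simp]:
  "spine_label i \<noteq> (InLeft c, b)" "(InLeft c, b) \<noteq> spine_label i"
  "spine_label i \<noteq> (InRight c, b)" "(InRight c, b) \<noteq> spine_label i"
  by (simp_all add: spine_label_def)

text \<open>Field number i sits at vertex i div 2 on edge (i + 1) div 2. Consecutive fields
  therefore share alternately an edge and a vertex; number 1 sits at the left center and number 2t
  at the right one.\<close>

lemma spine_label_vertex:
  "1 \<le> i \<Longrightarrow> (if odd i then glued_parent t (Spine ((i + 1) div 2)) else Spine ((i + 1) div 2)) = Spine (i div 2)"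
proof (cases "odd i")
  case True
  then obtain k where "i = 2 * k + 1" by (rule oddE)
  then show ?thesis by simp
next
  case False
  then obtain k where "i = 2 * k" by blast
  then show ?thesis by simp
qed

lemma conflict_spine_label:
  assumes "1 \<le> i"
  shows "glued_conflict t (spine_label i) y \<longleftrightarrow> spine_label i \<noteq> y \<and>
    (Spine ((i + 1) div 2) = fst y \<or> Spine (i div 2) = (if snd y then glued_parent t (fst y) else fst y))"
proof -
  have "fst (spine_label i) = Spine ((i + 1) div 2)" "snd (spine_label i) = odd i"
    by (simp_all add: spine_label_def)
  then show ?thesis unfolding tree_conflict_def by (simp only: spine_label_vertex[OF assms])
qed

lemma conflict_commute: "glued_conflict t x y \<longleftrightarrow> glued_conflict t y x"
  using tree_conflict_sym by metis

lemma conflict_spine [simp]: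
  assumes "1 \<le> i" "1 \<le> j"
  shows "glued_conflict t (spine_label i) (spine_label j) \<longleftrightarrow> i = Suc j \<or> j = Suc i"
proof -
  have "fst (spine_label j) = Spine ((j + 1) div 2)" "snd (spine_label j) = odd j"
    by (simp_all add: spine_label_def)
  then have "glued_conflict t (spine_label i) (spine_label j) \<longleftrightarrow>
      i \<noteq> j \<and> ((i + 1) div 2 = (j + 1) div 2 \<or> i div 2 = j div 2)"
    unfolding conflict_spine_label[OF assms(1)]
    by (simp only: spine_label_vertex[OF assms(2)] spine_label_inject glued_vertex.inject)
  moreover have "i \<noteq> j \<and> ((i + 1) div 2 = (j + 1) div 2 \<or> i div 2 = j div 2) \<longleftrightarrow> i = Suc j \<or> j = Suc i"
  proof -
    \<comment> \<open>The two parities of each index, in a form that turns the claim into linear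
      arithmetic over the halves.\<close>
    have "i = 2 * (i div 2) \<and> (i + 1) div 2 = i div 2 \<or> i = Suc (2 * (i div 2)) \<and> (i + 1) div 2 = Suc (i div 2)"
      and "j = 2 * (j div 2) \<and> (j + 1) div 2 = j div 2 \<or> j = Suc (2 * (j div 2)) \<and> (j + 1) div 2 = Suc (j div 2)"
      by arith+
    then show ?thesis by linarith
  qed
  ultimately show ?thesis by (simp only:)
qed

lemma conflict_spine_InLeft [simp]:
  assumes "1 \<le> i"
  shows "glued_conflict t (spine_label i) (InLeft c, b) \<longleftrightarrow> b \<and> glued_parent t (InLeft c) = Spine (i div 2)"
    and "glued_conflict t (InLeft c, b) (spine_label i) \<longleftrightarrow> b \<and> glued_parent t (InLeft c) = Spine (i div 2)"
proof -
  show *: "glued_conflict t (spine_label i) (InLeft c, b) \<longleftrightarrow> b \<and> glued_parent t (InLeft c) = Spine (i div 2)"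
    unfolding conflict_spine_label[OF assms] by auto
  show "glued_conflict t (InLeft c, b) (spine_label i) \<longleftrightarrow> b \<and> glued_parent t (InLeft c) = Spine (i div 2)"
    by (subst conflict_commute) (rule *)
qed

lemma conflict_spine_InRight [simp]:
  assumes "1 \<le> i"
  shows "glued_conflict t (spine_label i) (InRight c, b) \<longleftrightarrow> b \<and> glued_parent t (InRight c) = Spine (i div 2)"
    and "glued_conflict t (InRight c, b) (spine_label i) \<longleftrightarrow> b \<and> glued_parent t (InRight c) = Spine (i div 2)"
proof -
  show *: "glued_conflict t (spine_label i) (InRight c, b) \<longleftrightarrow> b \<and> glued_parent t (InRight c) = Spine (i div 2)"
    unfolding conflict_spine_label[OF assms] by auto
  show "glued_conflict t (InRight c, b) (spine_label i) \<longleftrightarrow> b \<and> glued_parent t (InRight c) = Spine (i div 2)"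
    by (subst conflict_commute) (rule *)
qed

lemma conflict_arms [simp]:
  "glued_conflict t (InLeft c, b) (InLeft c', b') \<longleftrightarrow> (c, b) \<noteq> (c', b') \<and> (c = c' \<or>
     (if b then glued_parent t (InLeft c) else InLeft c) = (if b' then glued_parent t (InLeft c') else InLeft c'))"
  "glued_conflict t (InRight c, b) (InRight c', b') \<longleftrightarrow> (c, b) \<noteq> (c', b') \<and> (c = c' \<or>
     (if b then glued_parent t (InRight c) else InRight c) = (if b' then glued_parent t (InRight c') else InRight c'))"
  "glued_conflict t (InLeft c, b) (InRight c', b') \<longleftrightarrow>
     (if b then glued_parent t (InLeft c) else InLeft c) = (if b' then glued_parent t (InRight c') else InRight c')"
  "glued_conflict t (InRight c, b) (InLeft c', b') \<longleftrightarrow>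
     (if b then glued_parent t (InRight c) else InRight c) = (if b' then glued_parent t (InLeft c') else InLeft c')"
  by (auto simp: tree_conflict_def)

lemma spine_labels: "Spine ` {1..t} \<times> UNIV = spine_label ` {1..2 * t}"
proof
  show "Spine ` {1..t} \<times> UNIV \<subseteq> spine_label ` {1..2 * t}"
  proof
    fix x assume "x \<in> Spine ` {1..t} \<times> (UNIV :: bool set)"
    then obtain m b where m: "1 \<le> m" "m \<le> t" "x = (Spine m, b)" by auto
    then have "x = spine_label (if b then 2 * m - 1 else 2 * m)"
      by (cases b) (auto simp: spine_label_def)
    moreover have "(if b then 2 * m - 1 else 2 * m) \<in> {1..2 * t}" using m by auto
    ultimately show "x \<in> spine_label ` {1..2 * t}" by blast
  qed
  show "spine_label ` {1..2 * t} \<subseteq> Spine ` {1..t} \<times> UNIV"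
  proof
    fix x assume "x \<in> spine_label ` {1..2 * t}"
    then obtain i where i: "1 \<le> i" "i \<le> 2 * t" "x = spine_label i" by auto
    then have "(i + 1) div 2 \<in> {1..t}" by auto
    then show "x \<in> Spine ` {1..t} \<times> UNIV" unfolding i(3) spine_label_def by blast
  qed
qed

section \<open>Folding the conflict graph\<close>

definition tip_labels :: "nat \<Rightarrow> nat \<Rightarrow> (glued_vertex \<times> bool) set" where
  "tip_labels n l = (InLeft ` Tip ` {..<n} \<union> InRight ` Tip ` {..<l}) \<times> UNIV"

definition leaf_labels :: "(glued_vertex \<times> bool) set" where
  "leaf_labels = {InLeft (Leaf 0)} \<times> UNIV"

text \<open>These are the fields at the right center on the arms there. They share this vertex, so
  they are pairwise in conflict: this is the source of the clique.\<close>

definition mid_labels :: "nat \<Rightarrow> (glued_vertex \<times> bool) set" where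
  "mid_labels l = InRight ` Mid ` {..<l} \<times> {True}"

abbreviation ind_realization :: "nat \<Rightarrow> (glued_vertex \<times> bool) set \<Rightarrow> (glued_vertex \<times> bool \<Rightarrow> real) topology" where
  "ind_realization t V \<equiv> geometric_realization (ind_complex V (glued_conflict t))"

lemma finite_labels [simp]: "finite (tip_labels n l)" "finite leaf_labels" "finite (mid_labels l)"
  by (simp_all add: tip_labels_def leaf_labels_def mid_labels_def)

lemma morse_complex_equivalent_ind_realization:
  "geometric_realization (morse_complex (path_two_stars t (extended_star 1 n) (extended_star 0 l)))
     homotopy_equivalent_space ind_realization t ((Spine ` {1..t} \<union> arm_verts n l) \<times> UNIV)"
proof -
  let ?C = "Spine ` {1..t} \<union> arm_verts n l"
  have par: "glued_parent t c \<in> insert (Spine 0) ?C \<and> glued_height t (glued_parent t c) < glued_height t c"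
    if "c \<in> ?C" for c
    using that by (auto simp: arm_verts_def image_iff)
  show ?thesis
    by (subst homotopy_equivalent_space_sym,
        rule morse_complex_rooted_tree[OF _ verts_path_two_stars edges_path_two_stars, where h = "glued_height t"])
      (use par in \<open>auto simp: arm_verts_def\<close>)
qed

text \<open>The field at a leaf or tip has a single neighbour, the other field on its edge, and so
  dominates whatever conflicts with that one. For the leaf these are the fields at
  \<open>Spine 0\<close>, for a tip the field at the middle vertex on the inner edge of the
  arm.\<close>

lemma ind_realization_fold_leaves:
  "ind_realization t ((Spine ` {1..t} \<union> arm_verts n l) \<times> UNIV) homotopy_equivalent_space
   ind_realization t (spine_label ` {2..2 * t} \<union> leaf_labels \<union> tip_labels n l \<union> mid_labels l)"
proof -
  let ?V = "(Spine ` {1..t} \<union> arm_verts n l) \<times> (UNIV :: bool set)"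
  let ?B = "insert (spine_label 1) (InLeft ` Mid ` {..<n} \<times> UNIV \<union> InRight ` Mid ` {..<l} \<times> {False})"
  have V: "?V = spine_label ` {1..2 * t} \<union> arm_verts n l \<times> UNIV"
    unfolding spine_labels[symmetric] by blast
  have V': "?V - ?B = spine_label ` {2..2 * t} \<union> leaf_labels \<union> tip_labels n l \<union> mid_labels l"
  proof -
    have "spine_label ` {1..2 * t} - ?B = spine_label ` {2..2 * t}" by force
    moreover have "arm_verts n l \<times> UNIV - ?B = leaf_labels \<union> tip_labels n l \<union> mid_labels l"
      by (auto simp: arm_verts_def leaf_labels_def tip_labels_def mid_labels_def)
    ultimately show ?thesis by (simp only: V Un_Diff Un_assoc)
  qed
  have "ind_realization t ?V homotopy_equivalent_space ind_realization t (?V - ?B)"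
  proof (rule ind_complex_fold[OF _ tree_conflict_sym])
    fix b assume b: "b \<in> ?B"
    consider (leaf) "b = spine_label 1 \<or> (\<exists>j. b = (InLeft (Mid j), True))"
      | (left) j where "j < n" "b = (InLeft (Mid j), False)"
      | (right) j where "j < l" "b = (InRight (Mid j), False)"
      using b by auto
    then show "\<exists>a\<in>?V - ?B. \<forall>x\<in>?V. glued_conflict t a x \<longrightarrow> glued_conflict t b x"
    proof cases
      case leaf
      show ?thesis
      proof (intro bexI ballI impI)
        show "(InLeft (Leaf 0), False) \<in> ?V - ?B" by (auto simp: arm_verts_def)
        fix x assume "x \<in> ?V" "glued_conflict t (InLeft (Leaf 0), False) x"
        then have "x = (InLeft (Leaf 0), True)" unfolding V by (auto simp: arm_verts_def split: if_splits)
        then show "glued_conflict t b x" using leaf by auto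
      qed
    next
      case left
      show ?thesis
      proof (intro bexI ballI impI)
        show "(InLeft (Tip j), False) \<in> ?V - ?B" using left by (auto simp: arm_verts_def)
        fix x assume "x \<in> ?V" "glued_conflict t (InLeft (Tip j), False) x"
        then have "x = (InLeft (Tip j), True)" unfolding V by (auto simp: arm_verts_def split: if_splits)
        then show "glued_conflict t b x" using left by auto
      qed
    next
      case right
      show ?thesis
      proof (intro bexI ballI impI)
        show "(InRight (Tip j), False) \<in> ?V - ?B" using right by (auto simp: arm_verts_def)
        fix x assume "x \<in> ?V" "glued_conflict t (InRight (Tip j), False) x"
        then have "x = (InRight (Tip j), True)" unfolding V by (auto simp: arm_verts_def split: if_splits)
        then show "glued_conflict t b x" using right by auto
      qed
    qed
  qed (simp add: arm_verts_def)
  then show ?thesis unfolding V' .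
qed

text \<open>Label 3w-1 dominates 3w+1 once 3w-2 is gone, for then 3w is its only neighbour. Each
  deletion makes the next one possible, so they are performed one by one and not as a single
  fold.\<close>

lemma ind_realization_fold_spine:
  "ind_realization t (spine_label ` {2..2 * t} \<union> leaf_labels \<union> tip_labels n l \<union> mid_labels l)
     homotopy_equivalent_space
   ind_realization t (spine_label ` {i \<in> {2..2 * t}. i mod 3 \<noteq> 1} \<union> leaf_labels \<union> tip_labels n l \<union> mid_labels l)"
proof -
  define L where "L = leaf_labels \<union> tip_labels n l \<union> mid_labels l"
  \<comment> \<open>The labels left after \<open>w\<close> steps. Step 0 concerns label 1, which is
    absent already, and steps beyond the end of the spine delete nothing, so 2t steps are
    enough.\<close>
  define W where "W w = spine_label ` ({2..2 * t} - (\<lambda>m. 3 * m + 1) ` {..<w}) \<union> L" for w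
  have finW: "finite (W w)" for w by (simp add: W_def L_def)
  have step: "ind_realization t (W w) homotopy_equivalent_space ind_realization t (W (Suc w))" for w
  proof -
    have "W w - {spine_label (3 * w + 1)} = W (Suc w)"
      by (auto simp: W_def L_def lessThan_Suc leaf_labels_def tip_labels_def mid_labels_def)
    moreover have "ind_realization t (W w) homotopy_equivalent_space
        ind_realization t (W w - {spine_label (3 * w + 1)})"
    proof (rule ind_complex_fold[OF finW tree_conflict_sym])
      fix b assume b: "b \<in> {spine_label (3 * w + 1)}" "b \<in> W w"
      then have w: "1 \<le> w" "3 * w + 1 \<le> 2 * t"
        by (auto simp: W_def L_def leaf_labels_def tip_labels_def mid_labels_def)
      have i: "1 \<le> 3 * w - 1" using w by simp
      show "\<exists>a\<in>W w - {spine_label (3 * w + 1)}.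
          \<forall>x\<in>W w. glued_conflict t a x \<longrightarrow> glued_conflict t b x"
      proof (intro bexI ballI impI)
        have "3 * w - 1 \<noteq> 3 * m + 1" for m by presburger
        then have "3 * w - 1 \<in> {2..2 * t} - (\<lambda>m. 3 * m + 1) ` {..<w}" using w by auto
        then show "spine_label (3 * w - 1) \<in> W w - {spine_label (3 * w + 1)}"
          unfolding W_def using w by simp
        fix x assume x: "x \<in> W w" "glued_conflict t (spine_label (3 * w - 1)) x"
        \<comment> \<open>The dominating field sits at neither center and hence meets no field of an
          arm.\<close>
        have half: "(3 * w - 1) div 2 \<noteq> 0" "(3 * w - 1) div 2 \<noteq> t" using w by auto
        have "x \<notin> L"
        proof
          assume "x \<in> L"
          then show False using x(2) half i
            by (auto simp: L_def leaf_labels_def tip_labels_def mid_labels_def)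
        qed
        then obtain j where j: "x = spine_label j" "2 \<le> j" "j \<notin> (\<lambda>m. 3 * m + 1) ` {..<w}"
          using x(1) by (auto simp: W_def)
        then have "3 * w - 1 = Suc j \<or> j = Suc (3 * w - 1)" using x(2) i by simp
        \<comment> \<open>The predecessor 3w-2 equals 3(w-1)+1 and was deleted in the step
          before.\<close>
        moreover have "3 * w - 1 \<noteq> Suc j"
        proof
          assume "3 * w - 1 = Suc j"
          then have "j = 3 * (w - 1) + 1" "w - 1 < w" using w by auto
          then show False using j(3) by blast
        qed
        ultimately have "j = 3 * w" using w by simp
        then show "glued_conflict t b x" using b j(1) w by simp
      qed
    qed
    ultimately show ?thesis by simp
  qed
  have "ind_realization t (W 0) homotopy_equivalent_space ind_realization t (W w)" for w
  proof (induction w)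
    case (Suc w)
    then show ?case using step homotopy_eqv_trans by blast
  qed (rule homotopy_equivalent_space_refl)
  from this[of "2 * t"]
  have "ind_realization t (W 0) homotopy_equivalent_space ind_realization t (W (2 * t))" .
  moreover have "{2..2 * t} - (\<lambda>m. 3 * m + 1) ` {..<2 * t} = {i \<in> {2..2 * t}. i mod 3 \<noteq> 1}"
  proof -
    have "i \<in> (\<lambda>m. 3 * m + 1) ` {..<2 * t} \<longleftrightarrow> i mod 3 = 1" if "i \<in> {2..2 * t}" for i
    proof
      assume "i mod 3 = 1"
      then have "i = 3 * (i div 3) + 1" using div_mult_mod_eq[of i 3] by simp
      moreover have "i div 3 \<in> {..<2 * t}" using that by auto
      ultimately show "i \<in> (\<lambda>m. 3 * m + 1) ` {..<2 * t}" by blast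
    qed auto
    then show ?thesis by blast
  qed
  ultimately show ?thesis by (simp add: W_def L_def Un_assoc)
qed

text \<open>For t = 3u the label 2t-2 has residue 1 and is deleted, so 2t is the only neighbour of
  2t-1; as 2t sits at the right center, 2t-1 dominates every field of \<open>mid_labels\<close>. For
  t = 0 the two centers coincide and the field at the leaf takes over this role.\<close>

lemma ind_realization_fold_mid:
  fixes t u n l :: nat
  assumes "t = 3 * u"
  shows "ind_realization t (spine_label ` {i \<in> {2..2 * t}. i mod 3 \<noteq> 1} \<union> leaf_labels \<union> tip_labels n l \<union> mid_labels l)
     homotopy_equivalent_space
   ind_realization t (spine_label ` {i \<in> {2..2 * t}. i mod 3 \<noteq> 1} \<union> leaf_labels \<union> tip_labels n l)"
proof -
  let ?W = "spine_label ` {i \<in> {2..2 * t}. i mod 3 \<noteq> 1} \<union> leaf_labels \<union> tip_labels n l"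
  have "(?W \<union> mid_labels l) - mid_labels l = ?W"
    by (auto simp: leaf_labels_def tip_labels_def mid_labels_def)
  moreover have "ind_realization t (?W \<union> mid_labels l) homotopy_equivalent_space
      ind_realization t ((?W \<union> mid_labels l) - mid_labels l)"
  proof (rule ind_complex_fold[OF _ tree_conflict_sym])
    fix b assume "b \<in> mid_labels l"
    then obtain j where b: "b = (InRight (Mid j), True)" by (auto simp: mid_labels_def)
    show "\<exists>a\<in>?W \<union> mid_labels l - mid_labels l.
        \<forall>x\<in>?W \<union> mid_labels l. glued_conflict t a x \<longrightarrow> glued_conflict t b x"
    proof (cases "u = 0")
      case True
      with assms have t: "t = 0" by simp
      show ?thesis
      proof (intro bexI ballI impI)
        show "(InLeft (Leaf 0), False) \<in> ?W \<union> mid_labels l - mid_labels l"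
          by (auto simp: leaf_labels_def mid_labels_def)
        fix x assume "x \<in> ?W \<union> mid_labels l" "glued_conflict t (InLeft (Leaf 0), False) x"
        then have "x = (InLeft (Leaf 0), True)"
          by (auto simp: t leaf_labels_def tip_labels_def mid_labels_def split: if_splits)
        then show "glued_conflict t b x" by (simp add: b t)
      qed
    next
      case False
      obtain v where v: "u = Suc v" using False by (cases u) auto
      \<comment> \<open>Displays the residue 2 of 2t-1, from which that of 2t-2 is read off
        below.\<close>
      have t: "2 * t - 1 = 3 * (2 * v + 1) + 2" using assms v by simp
      have i: "1 \<le> 2 * t - 1" "2 \<le> 2 * t - 1" using False assms by auto
      have half: "(2 * t - 1) div 2 \<noteq> 0" "(2 * t - 1) div 2 \<noteq> t" using False assms by auto
      show ?thesis
      proof (intro bexI ballI impI)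
        have "(2 * t - 1) mod 3 \<noteq> 1" unfolding t by presburger
        then have "spine_label (2 * t - 1) \<in> spine_label ` {i \<in> {2..2 * t}. i mod 3 \<noteq> 1}"
          using i by auto
        then show "spine_label (2 * t - 1) \<in> ?W \<union> mid_labels l - mid_labels l"
          by (auto simp: mid_labels_def)
        fix x assume x: "x \<in> ?W \<union> mid_labels l" "glued_conflict t (spine_label (2 * t - 1)) x"
        have "x \<notin> leaf_labels \<union> tip_labels n l \<union> mid_labels l"
        proof
          assume "x \<in> leaf_labels \<union> tip_labels n l \<union> mid_labels l"
          then show False using x(2) half i
            by (auto simp: leaf_labels_def tip_labels_def mid_labels_def)
        qed
        then obtain j where j: "x = spine_label j" "2 \<le> j" "j mod 3 \<noteq> 1" using x(1) by auto
        then have "2 * t - 1 = Suc j \<or> j = Suc (2 * t - 1)" using x(2) i by simp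
        moreover have "2 * t - 1 \<noteq> Suc j"
        proof
          assume "2 * t - 1 = Suc j"
          then have "j = 3 * (2 * v + 1) + 1" using t by simp
          then have "j mod 3 = 1" by presburger
          then show False using j(3) by simp
        qed
        ultimately have "j = 2 * t" using i by simp
        then show "glued_conflict t b x" using i by (simp add: b j(1))
      qed
    qed
  qed simp
  ultimately show ?thesis by simp
qed

section \<open>The matching and the clique left after folding\<close>

fun label_partner :: "glued_vertex \<times> bool \<Rightarrow> glued_vertex \<times> bool" where
  "label_partner (Spine m, b) = (if b then (Spine m, False) else (Spine (Suc m), True))"
| "label_partner (c, b) = (c, \<not> b)"

lemma label_partner_spine: "label_partner (spine_label i) = spine_label (Suc i)"
proof (cases "odd i")
  case True
  then obtain k where "i = 2 * k + 1" by (rule oddE)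
  then show ?thesis by (simp add: spine_label_def)
next
  case False
  then obtain k where "i = 2 * k" by blast
  then show ?thesis by (simp add: spine_label_def)
qed

lemma inj_label_partner: "inj label_partner"
proof (rule injI)
  fix x y assume "label_partner x = label_partner y"
  then show "x = y"
    by (cases x rule: label_partner.cases; cases y rule: label_partner.cases) (auto split: if_splits)
qed

text \<open>One end of every matching edge; \<open>label_partner\<close> supplies the other. The
  number \<open>w\<close> counts the pairs on the spine. The flag \<open>c\<close> tells whether the
  two leaf labels form a matching edge or are kept out to serve as the clique.\<close>

definition edge_labels :: "bool \<Rightarrow> nat \<Rightarrow> nat \<Rightarrow> nat \<Rightarrow> (glued_vertex \<times> bool) set" where
  "edge_labels c w n l = spine_label ` (\<lambda>m. 3 * m + 2) ` {..<w} \<union>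
     ((if c then {InLeft (Leaf 0)} else {}) \<union> (InLeft ` Tip ` {..<n} \<union> InRight ` Tip ` {..<l})) \<times> {True}"

abbreviation matched_labels :: "bool \<Rightarrow> nat \<Rightarrow> nat \<Rightarrow> nat \<Rightarrow> (glued_vertex \<times> bool) set" where
  "matched_labels c w n l \<equiv> edge_labels c w n l \<union> label_partner ` edge_labels c w n l"

lemma finite_edge_labels [simp]: "finite (edge_labels c w n l)"
  by (simp add: edge_labels_def)

lemma card_edge_labels: "card (edge_labels c w n l) = w + n + l + (if c then 1 else 0)"
proof -
  let ?L = "if c then {InLeft (Leaf 0)} else {}" and ?T = "InLeft ` Tip ` {..<n} \<union> InRight ` Tip ` {..<l}"
  have "card (spine_label ` (\<lambda>m. 3 * m + 2) ` {..<w}) = w"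
    by (simp add: image_image card_image inj_on_def)
  moreover have "card ?T = n + l"
    by (subst card_Un_disjoint) (auto simp: image_image card_image inj_on_def)
  then have "card (?L \<union> ?T) = n + l + (if c then 1 else 0)"
    by (subst card_Un_disjoint) auto
  then have "card ((?L \<union> ?T) \<times> {True}) = n + l + (if c then 1 else 0)"
    by (simp only: card_cartesian_product) simp
  moreover have "spine_label ` (\<lambda>m. 3 * m + 2) ` {..<w} \<inter> (?L \<union> ?T) \<times> {True} = {}" by auto
  ultimately show ?thesis
    unfolding edge_labels_def by (subst card_Un_disjoint) auto
qed

lemma label_partner_edge_labels:
  "label_partner ` edge_labels c w n l = spine_label ` (\<lambda>m. 3 * m + 3) ` {..<w} \<union>
     ((if c then {InLeft (Leaf 0)} else {}) \<union> (InLeft ` Tip ` {..<n} \<union> InRight ` Tip ` {..<l})) \<times> {False}"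
proof -
  have Suc: "Suc (3 * m + 2) = 3 * m + 3" for m by simp
  have "label_partner ` (X \<times> {True}) = X \<times> {False}" if "X \<subseteq> range InLeft \<union> range InRight" for X
  proof -
    have "label_partner (x, True) = (x, False)" if "x \<in> X" for x
      using that \<open>X \<subseteq> range InLeft \<union> range InRight\<close> by auto
    then show ?thesis by (force simp: image_iff)
  qed
  moreover have "(if c then {InLeft (Leaf 0)} else {}) \<union> (InLeft ` Tip ` {..<n} \<union> InRight ` Tip ` {..<l})
      \<subseteq> range InLeft \<union> range InRight" by auto
  moreover have "label_partner ` spine_label ` (\<lambda>m. 3 * m + 2) ` {..<w} = spine_label ` (\<lambda>m. 3 * m + 3) ` {..<w}"
    by (simp only: image_image label_partner_spine Suc)
  ultimately show ?thesis unfolding edge_labels_def image_Un[of label_partner] by (simp only:)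
qed

lemma matched_labels_cases:
  assumes "x \<in> matched_labels c w n l"
  obtains (spine) m where "m < w" "x = spine_label (3 * m + 2) \<or> x = spine_label (3 * m + 3)"
    | (left) j b where "j < n" "x = (InLeft (Tip j), b)"
    | (right) j b where "j < l" "x = (InRight (Tip j), b)"
    | (leaf) b where "c" "x = (InLeft (Leaf 0), b)"
proof -
  have "(\<exists>m<w. x = spine_label (3 * m + 2) \<or> x = spine_label (3 * m + 3)) \<or>
      (\<exists>j b. j < n \<and> x = (InLeft (Tip j), b)) \<or> (\<exists>j b. j < l \<and> x = (InRight (Tip j), b)) \<or>
      (\<exists>b. c \<and> x = (InLeft (Leaf 0), b))"
    using assms unfolding label_partner_edge_labels unfolding edge_labels_def by (auto split: if_splits)
  then show thesis using that by blast
qed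

lemma matched_labels_eq:
  "matched_labels c w n l = spine_label ` {i \<in> {2..3 * w}. i mod 3 \<noteq> 1} \<union>
     (if c then leaf_labels else {}) \<union> tip_labels n l"
proof -
  have mod3: "(3 * m + r) mod 3 = r mod 3" for m r :: nat by simp
  have "i \<in> (\<lambda>m. 3 * m + 2) ` {..<w} \<or> i \<in> (\<lambda>m. 3 * m + 3) ` {..<w}"
    if "2 \<le> i" "i \<le> 3 * w" "i mod 3 \<noteq> 1" for i
  proof (cases "i mod 3 = 2")
    case True
    then have "i = 3 * (i div 3) + 2" using div_mult_mod_eq[of i 3] by simp
    moreover have "i div 3 \<in> {..<w}" using that True div_mult_mod_eq[of i 3] by simp
    ultimately show ?thesis by blast
  next
    case False
    then have "i mod 3 = 0" using that(3) by linarith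
    then have "i = 3 * (i div 3 - 1) + 3" "i div 3 - 1 < w"
      using that div_mult_mod_eq[of i 3] by linarith+
    then show ?thesis by blast
  qed
  moreover have "3 * m + 2 \<in> {i \<in> {2..3 * w}. i mod 3 \<noteq> 1}" "3 * m + 3 \<in> {i \<in> {2..3 * w}. i mod 3 \<noteq> 1}"
    if "m < w" for m
    using that mod3[of m 2] mod3[of m 3] by simp_all
  ultimately have sp: "(\<lambda>m. 3 * m + 2) ` {..<w} \<union> (\<lambda>m. 3 * m + 3) ` {..<w} = {i \<in> {2..3 * w}. i mod 3 \<noteq> 1}"
    by (intro equalityI subsetI) (elim UnE imageE, simp_all)
  have split: "(A \<union> X \<times> {True}) \<union> (B \<union> X \<times> {False}) = (A \<union> B) \<union> X \<times> UNIV"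
    for A B and X :: "glued_vertex set" by auto
  have arms: "((if c then {InLeft (Leaf 0)} else {}) \<union> (InLeft ` Tip ` {..<n} \<union> InRight ` Tip ` {..<l})) \<times> UNIV
      = (if c then leaf_labels else {}) \<union> tip_labels n l"
    by (auto simp: leaf_labels_def tip_labels_def)
  have "matched_labels c w n l =
      spine_label ` ((\<lambda>m. 3 * m + 2) ` {..<w} \<union> (\<lambda>m. 3 * m + 3) ` {..<w}) \<union>
      (if c then leaf_labels else {}) \<union> tip_labels n l"
    unfolding label_partner_edge_labels unfolding edge_labels_def split arms image_Un[of spine_label]
    by (simp only: Un_assoc)
  then show ?thesis unfolding sp .
qed

lemma spine_label_in_edge_labels [simp]: "spine_label i \<in> edge_labels c w n l \<longleftrightarrow> (\<exists>m<w. i = 3 * m + 2)"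
  by (auto simp: edge_labels_def)

lemma arm_in_edge_labels [simp]:
  "(InLeft (Leaf 0), b) \<in> edge_labels c w n l \<longleftrightarrow> b \<and> c"
  "(InLeft (Tip j), b) \<in> edge_labels c w n l \<longleftrightarrow> b \<and> j < n"
  "(InRight (Tip j), b) \<in> edge_labels c w n l \<longleftrightarrow> b \<and> j < l"
  by (auto simp: edge_labels_def)

text \<open>The missing indices 3m+1 separate the spine into pairs, and an outer arm edge has lost
  every neighbour but the conflict between its own two fields.\<close>

lemma conflict_matched_labels:
  assumes "x \<in> matched_labels c w n l" "y \<in> matched_labels c w n l"
  shows "glued_conflict t x y \<longleftrightarrow>
    x \<in> edge_labels c w n l \<and> y = label_partner x \<or> y \<in> edge_labels c w n l \<and> x = label_partner y"
proof -
  have arith: "3 * m + 2 = Suc (3 * k + 3) \<longleftrightarrow> False" "3 * m + 2 = Suc (3 * k + 2) \<longleftrightarrow> False"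
    "3 * m + 3 = Suc (3 * k + 3) \<longleftrightarrow> False" "3 * m + 3 = Suc (3 * k + 2) \<longleftrightarrow> m = k"
    "3 * m + 3 = 3 * k + 2 \<longleftrightarrow> False" "3 * m + 2 = 3 * k + 3 \<longleftrightarrow> False"
    "3 * m + 2 = 3 * k + 2 \<longleftrightarrow> m = k" for m k :: nat by presburger+
  have one: "1 \<le> 3 * m + 2" "1 \<le> 3 * m + (3 :: nat)" for m by simp_all
  show ?thesis
    using assms(1)
  proof (cases rule: matched_labels_cases)
    case x: (spine m)
    \<comment> \<open>No matched spine label sits at \<open>Spine 0\<close>, so none meets the leaf
      labels.\<close>
    have i2: "(3 * m + 2) div 2 \<noteq> 0" "(3 * m + 3) div 2 \<noteq> 0" by simp_all
    show ?thesis
      using assms(2)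
    proof (cases rule: matched_labels_cases)
      case y: (spine k)
      show ?thesis
        using x y
        by (elim disjE; simp only: conflict_spine[OF one(1) one(1)] conflict_spine[OF one(1) one(2)]
            conflict_spine[OF one(2) one(1)] conflict_spine[OF one(2) one(2)]
            spine_label_in_edge_labels label_partner_spine spine_label_inject arith; blast)
    qed (use x i2 in \<open>auto simp: label_partner_spine\<close>)
  next
    case x: (left j b)
    show ?thesis
      using assms(2) by (cases rule: matched_labels_cases) (use x in \<open>auto simp: label_partner_spine\<close>)
  next
    case x: (right j b)
    show ?thesis
      using assms(2) by (cases rule: matched_labels_cases) (use x in \<open>auto simp: label_partner_spine\<close>)
  next
    case x: (leaf b)
    show ?thesis
      using assms(2) by (cases rule: matched_labels_cases) (use x in \<open>auto simp: label_partner_spine\<close>)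
  qed
qed

lemma conflict_matched_leaf:
  assumes "x \<in> matched_labels False w n l" "y \<in> leaf_labels"
  shows "x \<noteq> y \<and> \<not> glued_conflict t x y"
proof -
  obtain b where y: "y = (InLeft (Leaf 0), b)" using assms(2) by (auto simp: leaf_labels_def)
  show ?thesis
    using assms(1) by (cases rule: matched_labels_cases) (use y in auto)
qed

text \<open>The bound \<open>3 * w < 2 * t\<close> keeps the matched spine labels away from the
  right center. It also forces t > 0, so the leaf hangs at a different vertex.\<close>

lemma conflict_matched_mid:
  assumes "x \<in> matched_labels c w n l" "y \<in> mid_labels k" "3 * w < 2 * t"
  shows "x \<noteq> y \<and> \<not> glued_conflict t x y"
proof -
  obtain j where y: "y = (InRight (Mid j), True)" using assms(2) by (auto simp: mid_labels_def)
  show ?thesis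
    using assms(1) by (cases rule: matched_labels_cases) (use y assms(3) in auto)
qed

lemma conflict_matched_spine:
  assumes "x \<in> matched_labels c w n l" "3 * w + 2 \<le> i"
  shows "x \<noteq> spine_label i \<and> \<not> glued_conflict t x (spine_label i)"
  using assms(1) by (cases rule: matched_labels_cases) (use assms(2) in auto)

lemma conflict_mid: "x \<in> mid_labels l \<Longrightarrow> y \<in> mid_labels l \<Longrightarrow> glued_conflict t x y \<longleftrightarrow> x \<noteq> y"
  by (auto simp: mid_labels_def)

lemma conflict_leaf: "x \<in> leaf_labels \<Longrightarrow> y \<in> leaf_labels \<Longrightarrow> glued_conflict t x y \<longleftrightarrow> x \<noteq> y"
  by (auto simp: leaf_labels_def)

text \<open>Written as \<open>Suc 1\<close> to fit a clique of size \<open>Suc k\<close> with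
  \<open>k = 1\<close>, which gives one sphere.\<close>

lemma card_leaf_labels: "card leaf_labels = Suc 1"
  by (simp add: leaf_labels_def card_cartesian_product)

lemma card_mid_labels: "card (mid_labels l) = l"
  by (simp add: mid_labels_def card_cartesian_product card_image inj_on_def)

lemma edge_labels_disjoint: "edge_labels c w n l \<inter> label_partner ` edge_labels c w n l = {}"
proof -
  have "3 * m + 2 \<noteq> 3 * k + (3 :: nat)" for m k by presburger
  then have "(\<lambda>m. 3 * m + 2) ` {..<w} \<inter> (\<lambda>m. 3 * m + (3 :: nat)) ` {..<w} = {}" by blast
  moreover have "inj spine_label" by (simp add: inj_def)
  ultimately have "spine_label ` (\<lambda>m. 3 * m + 2) ` {..<w} \<inter> spine_label ` (\<lambda>m. 3 * m + 3) ` {..<w} = {}"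
    by (simp only: image_Int[symmetric] image_empty)
  moreover have "spine_label ` A \<inter> X \<times> {b} = {}" if "X \<subseteq> range InLeft \<union> range InRight" for A X b
    using that by auto
  moreover have "(if c then {InLeft (Leaf 0)} else {}) \<union> (InLeft ` Tip ` {..<n} \<union> InRight ` Tip ` {..<l})
      \<subseteq> range InLeft \<union> range InRight" by auto
  moreover have "X \<times> {True} \<inter> X \<times> {False} = {}" for X :: "glued_vertex set" by auto
  ultimately show ?thesis
    unfolding label_partner_edge_labels unfolding edge_labels_def Int_Un_distrib Int_Un_distrib2
    by (simp only: Int_commute[of "_ \<times> _" "spine_label ` _"] Un_empty_left)
qed

lemma ind_realization_clique:
  assumes J: "finite J" "card J = Suc k" "\<And>x y. x \<in> J \<Longrightarrow> y \<in> J \<Longrightarrow> glued_conflict t x y \<longleftrightarrow> x \<noteq> y"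
    and matched: "\<And>x y. x \<in> matched_labels c w n l \<Longrightarrow> y \<in> J \<Longrightarrow> x \<noteq> y \<and> \<not> glued_conflict t x y"
  shows "ind_realization t (matched_labels c w n l \<union> J)
     homotopy_equivalent_space sphere_wedge k (w + n + l + (if c then 1 else 0))"
proof (rule ind_complex_matching_clique[OF finite_edge_labels J(1) card_edge_labels J(2) _
      edge_labels_disjoint _ _ tree_conflict_sym conflict_matched_labels J(3)])
  show "inj_on label_partner (edge_labels c w n l)"
    using inj_label_partner by (rule inj_on_subset) simp
  show "edge_labels c w n l \<inter> J = {}" "label_partner ` edge_labels c w n l \<inter> J = {}"
    using matched by blast+
  show "\<not> glued_conflict t x y" if "x \<in> matched_labels c w n l" "y \<in> J" for x y
    using matched[OF that] by simp
qed

section \<open>The three residues of t modulo 3\<close>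

lemma morse_complex_folded:
  "geometric_realization (morse_complex (path_two_stars t (extended_star 1 n) (extended_star 0 l)))
     homotopy_equivalent_space
   ind_realization t (spine_label ` {i \<in> {2..2 * t}. i mod 3 \<noteq> 1} \<union> leaf_labels \<union> tip_labels n l \<union> mid_labels l)"
  by (rule homotopy_eqv_trans[OF morse_complex_equivalent_ind_realization
      homotopy_eqv_trans[OF ind_realization_fold_leaves ind_realization_fold_spine]])

text \<open>With \<open>mid_labels\<close> deleted everything left is a matching; its leaf edge is
  singled out as a clique of two vertices so that the general result applies. The remaining 2u + n +
  l edges give the dimension.\<close>

lemma morse_complex_mod_0:
  assumes "t = 3 * u"
  shows "geometric_realization (morse_complex (path_two_stars t (extended_star 1 n) (extended_star 0 l)))
     homotopy_equivalent_space nsphere (n + l + 2 * u)"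
proof -
  have "matched_labels False (2 * u) n l \<union> leaf_labels =
      spine_label ` {i \<in> {2..2 * t}. i mod 3 \<noteq> 1} \<union> leaf_labels \<union> tip_labels n l"
    unfolding matched_labels_eq using assms by auto
  moreover have "ind_realization t (matched_labels False (2 * u) n l \<union> leaf_labels)
      homotopy_equivalent_space sphere_wedge 1 (2 * u + n + l + (if False then 1 else 0))"
    by (rule ind_realization_clique[OF _ card_leaf_labels conflict_leaf conflict_matched_leaf]) simp_all
  moreover have "2 * u + n + l + (if False then 1 else 0) = n + l + 2 * u" by simp
  ultimately have "ind_realization t (spine_label ` {i \<in> {2..2 * t}. i mod 3 \<noteq> 1} \<union> leaf_labels \<union> tip_labels n l)
      homotopy_equivalent_space sphere_wedge 1 (n + l + 2 * u)" by (simp only:)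
  then have "ind_realization t (spine_label ` {i \<in> {2..2 * t}. i mod 3 \<noteq> 1} \<union> leaf_labels \<union> tip_labels n l)
      homotopy_equivalent_space nsphere (n + l + 2 * u)"
    by (rule homotopy_eqv_trans[OF _ homeomorphic_imp_homotopy_equivalent_space[OF sphere_wedge_one]])
  then show ?thesis
    by (rule homotopy_eqv_trans[OF homotopy_eqv_trans[OF morse_complex_folded ind_realization_fold_mid[OF assms]]])
qed

text \<open>Here 2t = 3(2u) + 2 has lost its partner to the end of the path. It sits at the right
  center like the fields of \<open>mid_labels\<close>, so together they form a clique of l + 1
  vertices. The leaf edge counts as a matching edge.\<close>

lemma morse_complex_mod_1:
  assumes "t = 3 * u + 1"
  shows "geometric_realization (morse_complex (path_two_stars t (extended_star 1 n) (extended_star 0 l)))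
     homotopy_equivalent_space sphere_wedge l (n + l + 2 * u + 1)"
proof -
  let ?J = "insert (spine_label (2 * t)) (mid_labels l)"
  have t0: "1 \<le> 2 * t" and w: "3 * (2 * u) < 2 * t" "3 * (2 * u) + 2 \<le> 2 * t" using assms by simp_all
  have spine_mid: "spine_label (2 * t) \<notin> mid_labels l" by (auto simp: mid_labels_def)
  have "{i \<in> {2..2 * t}. i mod 3 \<noteq> 1} = insert (2 * t) {i \<in> {2..3 * (2 * u)}. i mod 3 \<noteq> 1}"
  proof -
    have mod3: "(3 * m + r) mod 3 = r mod 3" for m r :: nat by simp
    have "i = 2 * t \<or> i \<le> 3 * (2 * u)" if "i \<le> 2 * t" "i mod 3 \<noteq> 1" for i
    proof -
      have "i \<noteq> 3 * (2 * u) + 1" using that(2) mod3[of "2 * u" 1] by auto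
      then show ?thesis using that(1) assms by linarith
    qed
    moreover have "2 * t = 3 * (2 * u) + 2" using assms by simp
    then have "(2 * t) mod 3 \<noteq> 1" using mod3[of "2 * u" 2] by simp
    ultimately show ?thesis using w by auto
  qed
  then have "matched_labels True (2 * u) n l \<union> ?J =
      spine_label ` {i \<in> {2..2 * t}. i mod 3 \<noteq> 1} \<union> leaf_labels \<union> tip_labels n l \<union> mid_labels l"
    unfolding matched_labels_eq by (simp only: image_insert) auto
  moreover have "ind_realization t (matched_labels True (2 * u) n l \<union> ?J)
     homotopy_equivalent_space sphere_wedge l (2 * u + n + l + (if True then 1 else 0))"
  proof (rule ind_realization_clique)
    show "finite ?J" "card ?J = Suc l" using spine_mid by (simp_all add: card_mid_labels)
    have meet: "glued_conflict t (spine_label (2 * t)) y" if "y \<in> mid_labels l" for y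
      using that t0 by (auto simp: mid_labels_def)
    fix x y assume "x \<in> ?J" "y \<in> ?J"
    then consider "x = spine_label (2 * t)" "y = spine_label (2 * t)"
      | "x = spine_label (2 * t)" "y \<in> mid_labels l" | "x \<in> mid_labels l" "y = spine_label (2 * t)"
      | "x \<in> mid_labels l" "y \<in> mid_labels l" by blast
    then show "glued_conflict t x y \<longleftrightarrow> x \<noteq> y"
    proof cases
      case 1
      then show ?thesis by (simp add: tree_conflict_def)
    next
      case 2
      then show ?thesis using meet spine_mid by auto
    next
      case 3
      then show ?thesis using meet spine_mid conflict_commute[of t x y] by auto
    next
      case 4
      then show ?thesis by (rule conflict_mid)
    qed
  next
    fix x y assume x: "x \<in> matched_labels True (2 * u) n l" and "y \<in> ?J"
    then show "x \<noteq> y \<and> \<not> glued_conflict t x y"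
      using conflict_matched_mid[OF x _ w(1)] conflict_matched_spine[OF x w(2)] by (elim insertE) simp_all
  qed
  moreover have "2 * u + n + l + (if True then 1 else 0) = n + l + 2 * u + 1" by simp
  ultimately have "ind_realization t (spine_label ` {i \<in> {2..2 * t}. i mod 3 \<noteq> 1} \<union> leaf_labels \<union>
      tip_labels n l \<union> mid_labels l) homotopy_equivalent_space sphere_wedge l (n + l + 2 * u + 1)"
    by (simp only:)
  then show ?thesis by (rule homotopy_eqv_trans[OF morse_complex_folded])
qed

text \<open>Here 2t = 3(2u+1) + 1 is deleted and the last pair ends at 2t-1, away from the right
  center, so the clique is \<open>mid_labels\<close> alone. The condition \<open>1 \<le> l\<close>
  makes it nonempty, and its l vertices give l - 1 spheres.\<close>

lemma morse_complex_mod_2: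
  assumes "t = 3 * u + 2" "1 \<le> l"
  shows "geometric_realization (morse_complex (path_two_stars t (extended_star 1 n) (extended_star 0 l)))
     homotopy_equivalent_space sphere_wedge (l - 1) (n + l + 2 * u + 2)"
proof -
  have w: "3 * (2 * u + 1) < 2 * t" using assms by simp
  have "{i \<in> {2..2 * t}. i mod 3 \<noteq> 1} = {i \<in> {2..3 * (2 * u + 1)}. i mod 3 \<noteq> 1}"
  proof -
    have mod3: "(3 * m + r) mod 3 = r mod 3" for m r :: nat by simp
    have "i \<le> 3 * (2 * u + 1)" if "i \<le> 2 * t" "i mod 3 \<noteq> 1" for i
    proof -
      have "i \<noteq> 3 * (2 * u + 1) + 1" using that(2) mod3[of "2 * u + 1" 1] by auto
      moreover have "2 * t = 3 * (2 * u + 1) + 1" using assms(1) by simp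
      ultimately show ?thesis using that(1) by linarith
    qed
    then show ?thesis using w by auto
  qed
  then have "matched_labels True (2 * u + 1) n l \<union> mid_labels l =
      spine_label ` {i \<in> {2..2 * t}. i mod 3 \<noteq> 1} \<union> leaf_labels \<union> tip_labels n l \<union> mid_labels l"
    unfolding matched_labels_eq by (simp only:) simp
  moreover have "ind_realization t (matched_labels True (2 * u + 1) n l \<union> mid_labels l)
      homotopy_equivalent_space sphere_wedge (l - 1) (2 * u + 1 + n + l + (if True then 1 else 0))"
    by (rule ind_realization_clique[OF _ _ conflict_mid conflict_matched_mid[OF _ _ w]])
      (use assms in \<open>simp_all add: card_mid_labels\<close>)
  moreover have "2 * u + 1 + n + l + (if True then 1 else 0) = n + l + 2 * u + 2" by simp
  ultimately have "ind_realization t (spine_label ` {i \<in> {2..2 * t}. i mod 3 \<noteq> 1} \<union> leaf_labels \<union>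
      tip_labels n l \<union> mid_labels l) homotopy_equivalent_space sphere_wedge (l - 1) (n + l + 2 * u + 2)"
    by (simp only:)
  then show ?thesis by (rule homotopy_eqv_trans[OF morse_complex_folded])
qed

theorem theorem4p4:
  fixes t n l u :: nat
  shows
    "(t = 3 * u \<longrightarrow>
        geometric_realization
          (morse_complex (path_two_stars t (extended_star 1 n) (extended_star 0 l)))
        homotopy_equivalent_space nsphere (n + l + 2 * u)) \<and>
     (t = 3 * u + 1 \<longrightarrow>
        geometric_realization
          (morse_complex (path_two_stars t (extended_star 1 n) (extended_star 0 l)))
        homotopy_equivalent_space sphere_wedge l (n + l + 2 * u + 1)) \<and>
     (t = 3 * u + 2 \<and> l \<ge> 1 \<longrightarrow>
        geometric_realization
          (morse_complex (path_two_stars t (extended_star 1 n) (extended_star 0 l)))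
        homotopy_equivalent_space sphere_wedge (l - 1) (n + l + 2 * u + 2))"
  using morse_complex_mod_0[of t u n l] morse_complex_mod_1[of t u n l] morse_complex_mod_2[of t u l n] by blast

end
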